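(* Consider the single-input single-output linear control system $$z(t+1)=Az(t)+Bu(t),\qquad \theta(t)=Cz(t)+\omega(t),$$ with $z(t)\in\mathbb{R}^N$, $u(t),\theta(t)\in\mathbb{R}$, where $\omega(t)$ is zero-mean i.i.d. Gaussian output noise with covariance $\Sigma_\omega$, and $u(t)$ is an i.i.d. Gaussian sequence with $\mathrm{E}[u(t)u(t+k)^\top]=0$ for all $k\neq0$ and $\mathrm{E}[z(t)u(t)^\top]=0$, and $z(t)$ is Gaussian. Let $\Sigma_z$ and $\Sigma_u$ be the covariances of $z(t)$ and $u(t)$. Then the information transfer from the whole state $z$ to the output $\theta$ from time $t$ to $t+1$ is $$T_{z\to\theta}=\frac12\log\frac{|\Sigma_{\theta'|\theta}|}{|\Sigma_\omega|},$$ where $$\Sigma_{\theta'|\theta}=C\Sigma_{z'}C^\top+\Sigma_\omega-(CA\Sigma_zC^\top)(C\Sigma_zC^\top)^{-1}(CA\Sigma_zC^\top)^\top,\qquad \Sigma_{z'}=A\Sigma_zA^\top+B\Sigma_uB^\top,$$ and $|\cdot|$ is the determinant.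
   Context: The (one-step) information transfer from the state $z$ to the output $\theta$ is $$T_{z\to\theta}=H(\theta(t+1)\mid\theta(t))-H_{\not z}(\theta(t+1)\mid\theta(t)),$$ where $H(\cdot\mid\cdot)$ is conditional differential entropy and $H_{\not z}$ is the same conditional entropy when $z$ is frozen (held at a constant deterministic value), so that, up to a constant shift, the output equation is $\theta_{\not z}(t)=\omega(t)$. The notation $\theta'$ means $\theta(t+1)$, $\theta$ means $\theta(t)$, and $\Sigma_{\theta'|\theta}$ is the conditional covariance of $\theta(t+1)$ given $\theta(t)$.
   Formalization: The inverted matrix is corrected from CΣ_zCᵀ to CΣ_zCᵀ+Σ_ω (the printed formula fails for A=C=Σ_z=Σ_ω=1, B=0); z(t),u(t) are taken jointly Gaussian, (ω(t),ω(t+1)) independent of (z(t),u(t)), and Σ_ω nonzero. *)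

theory Defs
  imports "HOL-Probability.Probability"
begin

text \<open>
  A random vector is Gaussian if each of its linear functionals is univariate normal. Standard
  deviation 0, that is a point mass, is allowed, so covariance matrices may be singular.
\<close>

definition normal_measure :: "real \<Rightarrow> real \<Rightarrow> real measure" where
  "normal_measure \<mu> \<sigma> =
     (if \<sigma> = 0 then return borel \<mu> else density lborel (\<lambda>x. ennreal (normal_density \<mu> \<sigma> x)))"

definition gaussian :: "'a measure \<Rightarrow> ('a \<Rightarrow> 'b::euclidean_space) \<Rightarrow> bool" where
  "gaussian M X \<longleftrightarrow> X \<in> borel_measurable M \<and>
     (\<forall>a. \<exists>\<mu> \<sigma>. 0 \<le> \<sigma> \<and> distr M borel (\<lambda>x. a \<bullet> X x) = normal_measure \<mu> \<sigma>)"

definition iid_gaussian :: "'a measure \<Rightarrow> (nat \<Rightarrow> 'a \<Rightarrow> 'b::euclidean_space) \<Rightarrow> bool" where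
  "iid_gaussian M X \<longleftrightarrow>
     prob_space.indep_vars M (\<lambda>_. borel) X UNIV \<and>
     (\<forall>s t. distr M borel (X s) = distr M borel (X t)) \<and>
     (\<forall>t. gaussian M (X t))"

text \<open>Unlike the library's \<open>indep_var\<close>, this allows values in different types.\<close>

definition indep_vectors ::
  "'a measure \<Rightarrow> ('a \<Rightarrow> 'b::euclidean_space) \<Rightarrow> ('a \<Rightarrow> 'c::euclidean_space) \<Rightarrow> bool" where
  "indep_vectors M X Y \<longleftrightarrow> X \<in> borel_measurable M \<and> Y \<in> borel_measurable M \<and>
     prob_space.indep_set M {X -` S \<inter> space M |S. S \<in> sets borel} {Y -` S \<inter> space M |S. S \<in> sets borel}"

text \<open>The matrix \<open>E[X Y\<^sup>T]\<close>.\<close>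

definition mean_outer :: "'a measure \<Rightarrow> ('a \<Rightarrow> real^'m) \<Rightarrow> ('a \<Rightarrow> real^'n) \<Rightarrow> real^'n^'m" where
  "mean_outer M X Y = (\<chi> i j. integral\<^sup>L M (\<lambda>x. X x $ i * Y x $ j))"

definition covariance :: "'a measure \<Rightarrow> ('a \<Rightarrow> real^'m) \<Rightarrow> real^'m^'m" where
  "covariance M X =
     mean_outer M (\<lambda>x. X x - integral\<^sup>L M X) (\<lambda>x. X x - integral\<^sup>L M X)"

text \<open>
  The random matrix \<open>E[(X - E[X | Y]) (X - E[X | Y])\<^sup>T | Y]\<close>; conditioning on \<open>Y\<close> means
  conditioning on the sigma-algebra generated by \<open>Y\<close>.
\<close>

definition cond_mean ::
  "'a measure \<Rightarrow> ('a \<Rightarrow> real^'m) \<Rightarrow> ('a \<Rightarrow> real^'n) \<Rightarrow> 'a \<Rightarrow> real^'m" where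
  "cond_mean M X Y x =
     (\<chi> i. real_cond_exp M (vimage_algebra (space M) Y borel) (\<lambda>x. X x $ i) x)"

definition cond_covariance ::
  "'a measure \<Rightarrow> ('a \<Rightarrow> real^'m) \<Rightarrow> ('a \<Rightarrow> real^'n) \<Rightarrow> 'a \<Rightarrow> real^'m^'m" where
  "cond_covariance M X Y x =
     (\<chi> i j. real_cond_exp M (vimage_algebra (space M) Y borel)
        (\<lambda>x. (X x - cond_mean M X Y x) $ i * (X x - cond_mean M X Y x) $ j) x)"

text \<open>
  With Lebesgue measure on both factors, the conditional entropy of the library is the
  conditional differential entropy (logarithms to base \<open>b\<close>).
\<close>

definition diff_cond_entropy ::
  "real \<Rightarrow> 'a measure \<Rightarrow> ('a \<Rightarrow> 'b::euclidean_space) \<Rightarrow> ('a \<Rightarrow> 'c::euclidean_space) \<Rightarrow> real" where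
  "diff_cond_entropy b M X Y = prob_space.conditional_entropy M b lborel lborel X Y"

text \<open>
  One-step information transfer to the output \<open>\<theta>\<close> from time \<open>t\<close> to \<open>t + 1\<close>;
  \<open>\<theta>\<^sub>f\<close> is the output of the system whose state is frozen.
\<close>

definition information_transfer ::
  "real \<Rightarrow> 'a measure \<Rightarrow> (nat \<Rightarrow> 'a \<Rightarrow> 'b::euclidean_space) \<Rightarrow> (nat \<Rightarrow> 'a \<Rightarrow> 'b) \<Rightarrow> nat \<Rightarrow> real" where
  "information_transfer b M \<theta> \<theta>\<^sub>f t =
     diff_cond_entropy b M (\<theta> (Suc t)) (\<theta> t) - diff_cond_entropy b M (\<theta>\<^sub>f (Suc t)) (\<theta>\<^sub>f t)"

definition frozen_output ::
  "real^'n^'m \<Rightarrow> real^'n \<Rightarrow> (nat \<Rightarrow> 'a \<Rightarrow> real^'m) \<Rightarrow> nat \<Rightarrow> 'a \<Rightarrow> real^'m" where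
  "frozen_output C z\<^sub>f \<omega> t x = C *v z\<^sub>f + \<omega> t x"

definition next_state_cov ::
  "real^'n^'n \<Rightarrow> real^'p^'n \<Rightarrow> real^'n^'n \<Rightarrow> real^'p^'p \<Rightarrow> real^'n^'n" where
  "next_state_cov A B \<Sigma>z \<Sigma>u = A ** \<Sigma>z ** transpose A + B ** \<Sigma>u ** transpose B"

text \<open>
  The matrix inverted here is the covariance \<open>C \<Sigma>z C\<^sup>T + \<Sigma>\<omega>\<close> of the output \<open>C z + \<omega>\<close>. The
  source prints only \<open>C \<Sigma>z C\<^sup>T\<close>, which is not the conditional covariance when \<open>\<Sigma>\<omega>\<close> is
  nonzero: for scalar \<open>A = C = \<Sigma>z = \<Sigma>\<omega> = 1\<close>, \<open>B = 0\<close> it would give \<open>1\<close> in place of \<open>3/2\<close>.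
\<close>

definition output_cond_cov ::
  "real^'n^'n \<Rightarrow> real^'p^'n \<Rightarrow> real^'n^'m \<Rightarrow> real^'n^'n \<Rightarrow> real^'p^'p \<Rightarrow> real^'m^'m \<Rightarrow> real^'m^'m" where
  "output_cond_cov A B C \<Sigma>z \<Sigma>u \<Sigma>\<omega> =
     C ** next_state_cov A B \<Sigma>z \<Sigma>u ** transpose C + \<Sigma>\<omega>
     - (C ** A ** \<Sigma>z ** transpose C)
       ** matrix_inv (C ** \<Sigma>z ** transpose C + \<Sigma>\<omega>)
       ** transpose (C ** A ** \<Sigma>z ** transpose C)"

end

theory Submission
  imports Defs
begin


text \<open>
  The outputs at times \<open>t\<close> and \<open>t + 1\<close> are jointly Gaussian, so the error \<open>V\<close> of the best linear
  predictor \<open>\<theta>(t + 1) = V + k \<theta>(t)\<close> is uncorrelated with, hence independent of, \<open>\<theta>(t)\<close>. Shifting by a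
  function of \<open>\<theta>(t)\<close> affects neither the conditional entropy nor the conditional covariance, so
  these are the entropy and the covariance of \<open>V\<close>; the variance of \<open>V\<close> is the Schur complement
  \<open>output_cond_cov\<close>, at least the noise variance. Freezing the state leaves the entropy of the noise,
  and the Gaussian entropies \<open>log (2 \<pi> e v) / 2\<close> differ by half the logarithm of the variance ratio.

  The mean of the input vanishes, although this is not assumed: \<open>E[u(r) u(s)] = 0\<close> for \<open>r \<noteq> s\<close> is
  the square of the mean because the inputs are i.i.d.
\<close>

section \<open>Gaussian vectors\<close>

text \<open>Gaussian vectors are given only through their one-dimensional projections, and the state
  covariance may be singular, so joint laws are handled by characteristic functions instead of
  densities: those of linear combinations are explicit in mean and variance, point masses included.
  The one genuinely two-dimensional step is to pass from a factorised joint characteristic function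
  to independence. Densities enter only after that, when the joint density of \<open>V\<close> and
  \<open>\<theta> t\<close> is a product; the nonzero noise variance makes both variances positive,
  so that these densities exist. A second obstacle is formal: the system equations hold only on
  \<open>space M\<close>, and outside it the states and outputs may differ from the formulas that
  describe them. This is the reason for the congruence lemmas.\<close>

lemma normal_measure_eq_distr:
  assumes "0 \<le> \<sigma>"
  shows "normal_measure \<mu> \<sigma> = distr std_normal_distribution borel (\<lambda>x. \<mu> + \<sigma> * x)"
proof -
  interpret N: real_distribution std_normal_distribution by (rule real_dist_normal_dist)
  show ?thesis
  proof (cases "\<sigma> = 0")
    case True
    then show ?thesis by (simp add: normal_measure_def)
  next
    case False
    have *: "distributed std_normal_distribution lborel (\<lambda>x. x) std_normal_density"
      by (simp add: distributed_def distr_id2)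
    have "distributed std_normal_distribution lborel (\<lambda>x. \<mu> + \<sigma> * x) (normal_density \<mu> \<sigma>)"
      using N.normal_density_affine[OF *, of \<sigma> \<mu>] False assms by simp
    then have "distr std_normal_distribution lborel (\<lambda>x. \<mu> + \<sigma> * x) = density lborel (normal_density \<mu> \<sigma>)"
      by (simp add: distributed_def)
    moreover have "distr std_normal_distribution lborel (\<lambda>x. \<mu> + \<sigma> * x)
        = distr std_normal_distribution borel (\<lambda>x. \<mu> + \<sigma> * x)"
      by (rule distr_cong) auto
    ultimately show ?thesis using False by (simp add: normal_measure_def)
  qed
qed

lemma real_distribution_normal_measure:
  assumes "0 \<le> \<sigma>"
  shows "real_distribution (normal_measure \<mu> \<sigma>)"
proof -
  interpret N: real_distribution std_normal_distribution by (rule real_dist_normal_dist)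
  show ?thesis by (simp add: normal_measure_eq_distr[OF assms])
qed

text \<open>Affine substitution in the standard normal law. The formula stays correct for
  \<open>\<sigma> = 0\<close>, where the second factor is 1, so degenerate laws need no separate
  treatment later.\<close>

lemma char_normal_measure:
  assumes "0 \<le> \<sigma>"
  shows "char (normal_measure \<mu> \<sigma>) t = iexp (t * \<mu>) * complex_of_real (exp (- ((t * \<sigma>)\<^sup>2) / 2))"
proof -
  have "char (normal_measure \<mu> \<sigma>) t = (CLINT x|std_normal_distribution. iexp (t * \<mu>) * iexp ((t * \<sigma>) * x))"
    unfolding char_def normal_measure_eq_distr[OF assms]
    by (subst integral_distr) (auto simp: algebra_simps exp_add)
  also have "\<dots> = iexp (t * \<mu>) * char std_normal_distribution (t * \<sigma>)"
    unfolding char_def by (rule integral_mult_right_zero)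
  finally show ?thesis by (simp add: char_std_normal_distribution)
qed

context prob_space
begin

context
  fixes W :: "'a \<Rightarrow> real" and \<mu> \<sigma> :: real
  assumes meas: "W \<in> borel_measurable M" and sd: "0 \<le> \<sigma>"
    and distr: "distr M borel W = normal_measure \<mu> \<sigma>"
begin

text \<open>Moments are pulled back to the standard normal law along the affine map. They identify
  the existentially quantified parameters in \<open>gaussian\<close> with mean and standard
  deviation.\<close>

lemma
  shows integrable_power2_normal_measure: "integrable M (\<lambda>x. (W x)\<^sup>2)"
    and expectation_normal_measure: "expectation W = \<mu>"
    and variance_normal_measure: "variance W = \<sigma>\<^sup>2"
proof -
  let ?N = std_normal_distribution
  interpret N: real_distribution ?N by (rule real_dist_normal_dist)
  note [measurable] = meas
  have i0: "integrable ?N (\<lambda>x. x)" and i2: "integrable ?N (\<lambda>x. x\<^sup>2)"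
    using integrable_std_normal_distribution_moment[of 1] integrable_std_normal_distribution_moment[of 2]
    by simp_all
  have e1: "integral\<^sup>L ?N (\<lambda>x. x) = 0" and e2: "integral\<^sup>L ?N (\<lambda>x. x\<^sup>2) = 1"
    using integral_std_normal_distribution_moment_odd[of 1] std_normal_distribution_even_moments(1)[of 1]
    by simp_all
  have eq: "distr M borel W = distr ?N borel (\<lambda>x. \<mu> + \<sigma> * x)"
    using distr normal_measure_eq_distr[OF sd] by simp
  have int: "(\<integral>x. f (W x) \<partial>M) = (\<integral>x. f (\<mu> + \<sigma> * x) \<partial>?N)" if [measurable]: "f \<in> borel_measurable borel"
    for f :: "real \<Rightarrow> real"
    using arg_cong[OF eq, of "\<lambda>N. integral\<^sup>L N f"] by (simp add: integral_distr)
  have "integrable ?N (\<lambda>x. (\<mu> + \<sigma> * x)\<^sup>2)"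
  proof -
    have "(\<lambda>x. (\<mu> + \<sigma> * x)\<^sup>2) = (\<lambda>x. \<mu>\<^sup>2 + (2 * \<mu> * \<sigma>) * x + \<sigma>\<^sup>2 * x\<^sup>2)"
      by (auto simp: power2_eq_square algebra_simps)
    then show ?thesis using i0 i2 by simp
  qed
  then have "integrable (distr ?N borel (\<lambda>x. \<mu> + \<sigma> * x)) (\<lambda>x. x\<^sup>2)"
    by (subst integrable_distr_eq) auto
  then have "integrable (distr M borel W) (\<lambda>x. x\<^sup>2)" unfolding eq .
  then show "integrable M (\<lambda>x. (W x)\<^sup>2)" by (subst (asm) integrable_distr_eq) auto
  have "expectation W = (\<integral>x. \<mu> + \<sigma> * x \<partial>?N)" by (rule int) simp
  also have "\<dots> = \<mu>" using i0 e1 N.prob_space by simp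
  finally show E: "expectation W = \<mu>" .
  have "variance W = (\<integral>x. (\<mu> + \<sigma> * x - \<mu>)\<^sup>2 \<partial>?N)" unfolding E by (rule int) simp
  also have "\<dots> = \<sigma>\<^sup>2" using e2 by (simp add: power_mult_distrib)
  finally show "variance W = \<sigma>\<^sup>2" .
qed

end

text \<open>On the line a functional is a scalar factor, so the point is that scaling preserves
  normality. The deviation becomes \<open>\<bar>a\<bar> * \<sigma>\<close> since \<open>a\<close>
  may be negative; \<open>a = 0\<close> gives a point mass.\<close>

lemma gaussian_real_iff:
  fixes W :: "'a \<Rightarrow> real"
  shows "gaussian M W \<longleftrightarrow>
    W \<in> borel_measurable M \<and> (\<exists>\<mu> \<sigma>. 0 \<le> \<sigma> \<and> distr M borel W = normal_measure \<mu> \<sigma>)"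
proof safe
  fix \<mu> \<sigma> :: real
  assume [measurable]: "W \<in> borel_measurable M" and \<sigma>: "0 \<le> \<sigma>" and W: "distr M borel W = normal_measure \<mu> \<sigma>"
  have "distr M borel (\<lambda>x. a \<bullet> W x) = normal_measure (a * \<mu>) (\<bar>a\<bar> * \<sigma>)" for a
  proof (rule Levy_uniqueness)
    show "char (distr M borel (\<lambda>x. a \<bullet> W x)) = char (normal_measure (a * \<mu>) (\<bar>a\<bar> * \<sigma>))"
    proof
      fix t
      have "char (distr M borel (\<lambda>x. a \<bullet> W x)) t = char (distr M borel W) (t * a)"
        by (simp add: char_def integral_distr mult.assoc)
      then show "char (distr M borel (\<lambda>x. a \<bullet> W x)) t = char (normal_measure (a * \<mu>) (\<bar>a\<bar> * \<sigma>)) t"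
        by (simp add: W char_normal_measure \<sigma> power_mult_distrib mult.assoc)
    qed
  qed (use \<sigma> in \<open>auto intro!: real_distribution_normal_measure\<close>)
  then show "gaussian M W"
    using \<sigma> unfolding gaussian_def
    by (intro conjI allI exI[of _ "_ * \<mu>"] exI[of _ "\<bar>_\<bar> * \<sigma>"]) auto
next
  assume g: "gaussian M W"
  then show "W \<in> borel_measurable M" by (simp add: gaussian_def)
  show "\<exists>\<mu> \<sigma>. 0 \<le> \<sigma> \<and> distr M borel W = normal_measure \<mu> \<sigma>"
    using g unfolding gaussian_def by (elim conjE allE[of _ 1]) simp
qed

lemma gaussian_iff_inner:
  fixes X :: "'a \<Rightarrow> 'b::euclidean_space"
  shows "gaussian M X \<longleftrightarrow> X \<in> borel_measurable M \<and> (\<forall>a. gaussian M (\<lambda>x. a \<bullet> X x))"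
proof -
  have "X \<in> borel_measurable M \<Longrightarrow> gaussian M (\<lambda>x. a \<bullet> X x) \<longleftrightarrow>
      (\<exists>\<mu> \<sigma>. 0 \<le> \<sigma> \<and> distr M borel (\<lambda>x. a \<bullet> X x) = normal_measure \<mu> \<sigma>)" for a
    by (simp add: gaussian_real_iff)
  then show ?thesis by (auto simp: gaussian_def)
qed

text \<open>The adjoint turns a functional of the image into a functional of \<open>X\<close>. Hence
  \<open>L\<close> may be singular and may change the dimension.\<close>

lemma gaussian_linear:
  fixes X :: "'a \<Rightarrow> 'b::euclidean_space" and L :: "'b \<Rightarrow> 'c::euclidean_space"
  assumes X: "gaussian M X" and L: "linear L"
  shows "gaussian M (\<lambda>x. L (X x))"
proof -
  have [measurable]: "X \<in> borel_measurable M" using X by (simp add: gaussian_def)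
  have [measurable]: "L \<in> borel_measurable borel"
    using L by (intro borel_measurable_continuous_onI linear_continuous_on linear_conv_bounded_linear[THEN iffD1])
  have "a \<bullet> L y = adjoint L a \<bullet> y" for a y by (simp add: adjoint_works[OF L] inner_commute)
  then show ?thesis using X gaussian_iff_inner[of X] by (simp add: gaussian_iff_inner[of "\<lambda>x. L (X x)"])
qed

lemma gaussian_integrable_norm_power2:
  fixes X :: "'a \<Rightarrow> 'b::euclidean_space"
  assumes "gaussian M X"
  shows "integrable M (\<lambda>x. (norm (X x))\<^sup>2)"
proof -
  have "integrable M (\<lambda>x. (X x \<bullet> b)\<^sup>2)" for b
  proof -
    have "gaussian M (\<lambda>x. b \<bullet> X x)" using assms unfolding gaussian_iff_inner[of X] by blast
    then obtain \<mu> \<sigma> where "(\<lambda>x. b \<bullet> X x) \<in> borel_measurable M" "0 \<le> \<sigma>"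
      "distr M borel (\<lambda>x. b \<bullet> X x) = normal_measure \<mu> \<sigma>"
      unfolding gaussian_real_iff by blast
    then show ?thesis
      unfolding inner_commute[of _ b] by (rule integrable_power2_normal_measure)
  qed
  then have "integrable M (\<lambda>x. \<Sum>b\<in>Basis. (X x \<bullet> b)\<^sup>2)" by (rule Bochner_Integration.integrable_sum)
  then show ?thesis unfolding power2_norm_eq_inner by (subst euclidean_inner) (simp add: power2_eq_square)
qed

lemma char_gaussian:
  fixes W :: "'a \<Rightarrow> real"
  assumes "gaussian M W"
  shows "char (distr M borel W) t
    = iexp (t * expectation W) * complex_of_real (exp (- (t\<^sup>2 * variance W) / 2))"
proof -
  obtain \<mu> \<sigma> where W: "W \<in> borel_measurable M" "0 \<le> \<sigma>" "distr M borel W = normal_measure \<mu> \<sigma>"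
    using assms unfolding gaussian_real_iff by blast
  show ?thesis
    unfolding variance_normal_measure[OF W] unfolding expectation_normal_measure[OF W] W(3)
    using W(2) by (simp add: char_normal_measure power_mult_distrib)
qed

lemma gaussian_distributed:
  fixes W :: "'a \<Rightarrow> real"
  assumes "gaussian M W" "variance W \<noteq> 0"
  shows "distributed M lborel W (normal_density (expectation W) (sqrt (variance W)))"
proof -
  obtain \<mu> \<sigma> where W: "W \<in> borel_measurable M" "0 \<le> \<sigma>" "distr M borel W = normal_measure \<mu> \<sigma>"
    using assms(1) unfolding gaussian_real_iff by blast
  note v = variance_normal_measure[OF W] and e = expectation_normal_measure[OF W]
  have "\<sigma> \<noteq> 0" using v assms(2) by auto
  moreover have "distr M lborel W = distr M borel W" by (rule distr_cong) auto
  ultimately show ?thesis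
    unfolding v unfolding e using W by (simp add: distributed_def normal_measure_def)
qed

section \<open>Independence of random vectors with values in different spaces\<close>

lemma indep_vectors_iff:
  fixes X :: "'a \<Rightarrow> 'b::euclidean_space" and Y :: "'a \<Rightarrow> 'c::euclidean_space"
  shows "indep_vectors M X Y \<longleftrightarrow> X \<in> borel_measurable M \<and> Y \<in> borel_measurable M \<and>
    (\<forall>A\<in>sets borel. \<forall>B\<in>sets borel. prob ((X -` A \<inter> space M) \<inter> (Y -` B \<inter> space M))
       = prob (X -` A \<inter> space M) * prob (Y -` B \<inter> space M))"
proof (intro iffI conjI ballI)
  assume i: "indep_vectors M X Y"
  then show "X \<in> borel_measurable M" "Y \<in> borel_measurable M" by (auto simp: indep_vectors_def)
  fix A :: "'b set" and B :: "'c set" assume "A \<in> sets borel" "B \<in> sets borel"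
  then show "prob ((X -` A \<inter> space M) \<inter> (Y -` B \<inter> space M)) = prob (X -` A \<inter> space M) * prob (Y -` B \<inter> space M)"
    using i unfolding indep_vectors_def by (intro indep_setD) auto
next
  assume i: "X \<in> borel_measurable M \<and> Y \<in> borel_measurable M \<and>
    (\<forall>A\<in>sets borel. \<forall>B\<in>sets borel. prob ((X -` A \<inter> space M) \<inter> (Y -` B \<inter> space M))
       = prob (X -` A \<inter> space M) * prob (Y -` B \<inter> space M))"
  then show "indep_vectors M X Y"
    unfolding indep_vectors_def by (intro conjI indep_setI) (blast intro: measurable_sets)+
qed

lemma indep_vectors_comp:
  fixes X :: "'a \<Rightarrow> 'b::euclidean_space" and Y :: "'a \<Rightarrow> 'c::euclidean_space"
    and f :: "'b \<Rightarrow> 'd::euclidean_space" and g :: "'c \<Rightarrow> 'e::euclidean_space"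
  assumes ind: "indep_vectors M X Y" and [measurable]: "f \<in> borel_measurable borel" "g \<in> borel_measurable borel"
  shows "indep_vectors M (\<lambda>x. f (X x)) (\<lambda>x. g (Y x))"
  unfolding indep_vectors_iff
proof (intro conjI ballI)
  have [measurable]: "X \<in> borel_measurable M" "Y \<in> borel_measurable M"
    using ind by (auto simp: indep_vectors_iff)
  show "(\<lambda>x. f (X x)) \<in> borel_measurable M" "(\<lambda>x. g (Y x)) \<in> borel_measurable M" by measurable
  fix A :: "'d set" and B :: "'e set" assume AB: "A \<in> sets borel" "B \<in> sets borel"
  then have "f -` A \<in> sets borel" "g -` B \<in> sets borel"
    using measurable_sets[OF assms(2)] measurable_sets[OF assms(3)] by auto
  then show "prob ((\<lambda>x. f (X x)) -` A \<inter> space M \<inter> ((\<lambda>x. g (Y x)) -` B \<inter> space M))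
    = prob ((\<lambda>x. f (X x)) -` A \<inter> space M) * prob ((\<lambda>x. g (Y x)) -` B \<inter> space M)"
    using ind[unfolded indep_vectors_iff, THEN conjunct2, THEN conjunct2, rule_format, of "f -` A" "g -` B"]
    by (simp add: vimage_def)
qed

text \<open>\<open>indep_var\<close> speaks of generated sigma-algebras,
  \<open>indep_vectors\<close> of preimages of Borel sets. These preimages are closed under
  intersection, so the product rule extends to the sigma-algebras that they generate.\<close>

lemma indep_var_iff_indep_vectors:
  fixes X Y :: "'a \<Rightarrow> 'b::euclidean_space"
  shows "indep_var borel X borel Y \<longleftrightarrow> indep_vectors M X Y"
proof
  assume i: "indep_var borel X borel Y"
  have m: "X \<in> borel_measurable M" "Y \<in> borel_measurable M"
    using i indep_var_rv1 indep_var_rv2 by blast+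
  have v: "(\<lambda>x. (X x, Y x)) -` (A \<times> B) \<inter> space M = (X -` A \<inter> space M) \<inter> (Y -` B \<inter> space M)" for A B by auto
  show "indep_vectors M X Y"
    unfolding indep_vectors_iff using m indep_varD[OF i] unfolding v by blast
next
  assume i: "indep_vectors M X Y"
  then have m: "X \<in> borel_measurable M" "Y \<in> borel_measurable M" by (auto simp: indep_vectors_iff)
  show "indep_var borel X borel Y" unfolding indep_var_eq
  proof (intro conjI indep_set_sigma_sets m)
    have "Int_stable {Z -` A \<inter> space M |A. A \<in> sets borel}" for Z :: "'a \<Rightarrow> 'b"
    proof (rule Int_stableI, clarify)
      fix A B :: "'b set" assume "A \<in> sets borel" "B \<in> sets borel"
      then show "\<exists>C. Z -` A \<inter> space M \<inter> (Z -` B \<inter> space M) = Z -` C \<inter> space M \<and> C \<in> sets borel"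
        by (intro exI[of _ "A \<inter> B"]) auto
    qed
    then show "Int_stable {X -` A \<inter> space M |A. A \<in> sets borel}" "Int_stable {Y -` A \<inter> space M |A. A \<in> sets borel}"
      by this+
    show "indep_set {X -` A \<inter> space M |A. A \<in> sets borel} {Y -` A \<inter> space M |A. A \<in> sets borel}"
      using i by (simp add: indep_vectors_def)
  qed
qed

text \<open>Each functional is a sum of two independent normal variables, whose characteristic
  functions multiply: means and variances add. Levy uniqueness identifies the law, also when both
  deviations vanish.\<close>

lemma gaussian_add:
  fixes X Y :: "'a \<Rightarrow> 'b::euclidean_space"
  assumes X: "gaussian M X" and Y: "gaussian M Y" and ind: "indep_vectors M X Y"
  shows "gaussian M (\<lambda>x. X x + Y x)"
proof -
  have [measurable]: "X \<in> borel_measurable M" "Y \<in> borel_measurable M"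
    using X Y by (auto simp: gaussian_def)
  have "gaussian M (\<lambda>x. a \<bullet> (X x + Y x))" for a
  proof -
    obtain \<mu> \<sigma> where 1: "0 \<le> \<sigma>" "distr M borel (\<lambda>x. a \<bullet> X x) = normal_measure \<mu> \<sigma>"
      using X unfolding gaussian_def by blast
    obtain \<nu> \<tau> where 2: "0 \<le> \<tau>" "distr M borel (\<lambda>x. a \<bullet> Y x) = normal_measure \<nu> \<tau>"
      using Y unfolding gaussian_def by blast
    have i: "indep_var borel (\<lambda>x. a \<bullet> X x) borel (\<lambda>x. a \<bullet> Y x)"
      unfolding indep_var_iff_indep_vectors by (rule indep_vectors_comp[OF ind]) auto
    let ?s = "sqrt (\<sigma>\<^sup>2 + \<tau>\<^sup>2)"
    have "distr M borel (\<lambda>x. a \<bullet> (X x + Y x)) = normal_measure (\<mu> + \<nu>) ?s"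
    proof (rule Levy_uniqueness)
      show "char (distr M borel (\<lambda>x. a \<bullet> (X x + Y x))) = char (normal_measure (\<mu> + \<nu>) ?s)"
      proof
        fix t :: real
        let ?e = "\<lambda>s::real. exp (- ((t * s)\<^sup>2) / 2)"
        have "?e \<sigma> * ?e \<tau> = exp (- ((t * \<sigma>)\<^sup>2) / 2 + - ((t * \<tau>)\<^sup>2) / 2)"
          by (rule exp_add[symmetric])
        also have "- ((t * \<sigma>)\<^sup>2) / 2 + - ((t * \<tau>)\<^sup>2) / 2 = - ((t * ?s)\<^sup>2) / 2"
          by (simp add: power_mult_distrib field_simps)
        finally have e: "?e \<sigma> * ?e \<tau> = ?e ?s" .
        have "char (distr M borel (\<lambda>x. a \<bullet> (X x + Y x))) t
            = (iexp (t * \<mu>) * complex_of_real (?e \<sigma>)) * (iexp (t * \<nu>) * complex_of_real (?e \<tau>))"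
          unfolding inner_add_right char_distr_add[OF i] 1 2
          by (simp only: char_normal_measure 1(1) 2(1))
        also have "\<dots> = (iexp (t * \<mu>) * iexp (t * \<nu>)) * complex_of_real (?e \<sigma> * ?e \<tau>)"
          unfolding of_real_mult by (simp only: mult_ac)
        also have "iexp (t * \<mu>) * iexp (t * \<nu>) = iexp (t * (\<mu> + \<nu>))"
          by (simp add: distrib_left exp_add)
        also have "iexp (t * (\<mu> + \<nu>)) * complex_of_real (?e \<sigma> * ?e \<tau>) = char (normal_measure (\<mu> + \<nu>) ?s) t"
          unfolding e by (rule char_normal_measure[symmetric]) simp
        finally show "char (distr M borel (\<lambda>x. a \<bullet> (X x + Y x))) t = char (normal_measure (\<mu> + \<nu>) ?s) t" .
      qed
    qed (auto intro!: real_distribution_normal_measure)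
    then show ?thesis unfolding gaussian_real_iff by (intro conjI exI[of _ "\<mu>+\<nu>"] exI[of _ ?s]) auto
  qed
  then show ?thesis by (simp add: gaussian_iff_inner[of "\<lambda>x. X x + Y x"])
qed

end


section \<open>Uncorrelated jointly Gaussian variables are independent\<close>

context prob_space
begin

text \<open>Once \<open>g\<close> is normalised to a probability density, the hypothesis says that
  \<open>Y\<close> has the same characteristic function under the reweighted measure as under
  \<open>M\<close>. Levy uniqueness makes the two laws of \<open>Y\<close> equal, and the claim
  compares them on \<open>A\<close>. If \<open>expectation g = 0\<close>, then \<open>g\<close>
  vanishes almost everywhere and both sides are 0.\<close>

lemma expectation_indicator_of_char:
  fixes g Y :: "'a \<Rightarrow> real"
  assumes [measurable]: "Y \<in> borel_measurable M" and g: "integrable M g" and nn: "\<And>x. 0 \<le> g x"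
    and char: "\<And>t. (CLINT x|M. complex_of_real (g x) * iexp (t * Y x))
      = complex_of_real (expectation g) * (CLINT x|M. iexp (t * Y x))"
    and A[measurable]: "A \<in> sets borel"
  shows "expectation (\<lambda>x. g x * indicator A (Y x)) = expectation g * prob (Y -` A \<inter> space M)"
proof (cases "expectation g = 0")
  case True
  then have "AE x in M. g x = 0"
    using integral_nonneg_eq_0_iff_AE[OF g] nn by simp
  then have "expectation (\<lambda>x. g x * indicator A (Y x)) = 0"
    by (intro integral_eq_zero_AE) auto
  then show ?thesis using True by simp
next
  case False
  define c where "c = expectation g"
  have c: "0 < c" using False Bochner_Integration.integral_nonneg[of M g] nn unfolding c_def by (simp add: less_le)
  note [measurable] = borel_measurable_integrable[OF g]
  define D where "D = density M (\<lambda>x. ennreal (g x / c))"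
  have D: "prob_space D"
  proof
    have "emeasure D (space D) = (\<integral>\<^sup>+x. ennreal (g x / c) \<partial>M)"
      unfolding D_def by (subst emeasure_density) (auto intro!: nn_integral_cong)
    also have "\<dots> = ennreal (\<integral>x. g x / c \<partial>M)"
      using g nn c by (intro nn_integral_eq_integral) auto
    also have "\<dots> = 1" using c by (simp add: c_def)
    finally show "emeasure D (space D) = 1" .
  qed
  have [measurable]: "Y \<in> borel_measurable D" by (simp add: D_def)
  have eq: "distr D borel Y = distr M borel Y"
  proof (rule Levy_uniqueness)
    show "char (distr D borel Y) = char (distr M borel Y)"
    proof
      fix t
      have "char (distr D borel Y) t = (CLINT x|D. iexp (t * Y x))"
        by (simp add: char_def integral_distr)
      also have "\<dots> = (CLINT x|M. (g x / c) *\<^sub>R iexp (t * Y x))"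
        unfolding D_def using nn c by (intro integral_density) auto
      also have "\<dots> = (CLINT x|M. complex_of_real (1 / c) * (complex_of_real (g x) * iexp (t * Y x)))"
        by (intro Bochner_Integration.integral_cong) (auto simp: scaleR_conv_of_real)
      also have "\<dots> = complex_of_real (1 / c) * (complex_of_real c * (CLINT x|M. iexp (t * Y x)))"
        unfolding c_def char[symmetric] by (rule integral_mult_right_zero)
      also have "\<dots> = char (distr M borel Y) t"
        using c by (simp add: char_def integral_distr)
      finally show "char (distr D borel Y) t = char (distr M borel Y) t" .
    qed
  qed (auto intro!: prob_space.real_distribution_distr[OF D])
  have "prob (Y -` A \<inter> space M) = (\<integral>y. indicator A y \<partial>distr M borel Y)"
    by (simp add: measure_distr)
  also have "\<dots> = (\<integral>x. indicator A (Y x) \<partial>D)"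
    unfolding eq[symmetric] by (subst integral_distr) auto
  also have "\<dots> = (\<integral>x. (g x / c) *\<^sub>R indicator A (Y x) \<partial>M)"
    unfolding D_def using nn c by (intro integral_density) auto
  also have "\<dots> = (\<integral>x. (g x * indicator A (Y x)) / c \<partial>M)" by simp
  also have "\<dots> = expectation (\<lambda>x. g x * indicator A (Y x)) / c" by (rule integral_divide_zero)
  finally show ?thesis using c by (simp add: c_def field_simps)
qed

text \<open>
  Kac's theorem, reduced to the one-dimensional Levy uniqueness theorem: reweighting \<open>M\<close> by the
  positive functions \<open>2 + Re (c * iexp (s * X))\<close> preserves the law of \<open>Y\<close>. Hence restricting to
  \<open>Y \<in> A\<close> preserves the characteristic function of \<open>X\<close> up to a factor, and with it the law of \<open>X\<close>.
\<close>

theorem indep_var_of_char: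
  fixes X Y :: "'a \<Rightarrow> real"
  assumes X[measurable]: "X \<in> borel_measurable M" and Y[measurable]: "Y \<in> borel_measurable M"
    and char: "\<And>s t. (CLINT x|M. iexp (s * X x + t * Y x))
      = (CLINT x|M. iexp (s * X x)) * (CLINT x|M. iexp (t * Y x))"
  shows "indep_var borel X borel Y"
proof -
  have int[simp]: "integrable M (\<lambda>x. iexp (s * X x))" "integrable M (\<lambda>x. iexp (t * Y x))"
      "integrable M (\<lambda>x. iexp (s * X x) * iexp (t * Y x))" for s t
    using integrable_iexp[of "\<lambda>x. s * X x"] integrable_iexp[of "\<lambda>x. t * Y x"]
      integrable_iexp[of "\<lambda>x. s * X x + t * Y x"] by (simp_all add: distrib_left exp_add)
  have char': "(CLINT x|M. iexp (s * X x) * iexp (t * Y x))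
      = (CLINT x|M. iexp (s * X x)) * (CLINT x|M. iexp (t * Y x))" for s t
    using char[of s t] by (simp add: distrib_left exp_add)
  \<comment> \<open>Conjugating \<open>iexp r\<close> gives \<open>iexp (- r)\<close>, so the weight
    is a combination of a constant and two exponentials. This opens it to \<open>char'\<close>, used
    at the frequencies \<open>s\<close> and \<open>- s\<close>.\<close>
  have re: "complex_of_real (2 + Re (c * iexp r)) = 2 + c / 2 * iexp r + cnj c / 2 * iexp (- r)" for c r
  proof -
    have "complex_of_real (Re (c * iexp r)) = (c * iexp r + cnj (c * iexp r)) / 2"
      unfolding complex_add_cnj by simp
    also have "cnj (c * iexp r) = cnj c * iexp (- r)" by (simp add: exp_cnj)
    finally show ?thesis by (simp add: add_divide_distrib)
  qed
  have tilt: "expectation (\<lambda>x. Re (c * iexp (s * X x)) * indicator A (Y x))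
      = expectation (\<lambda>x. Re (c * iexp (s * X x))) * prob (Y -` A \<inter> space M)"
    if c: "norm c = 1" and A[measurable]: "A \<in> sets borel" for c s A
  proof -
    define f where "f x = Re (c * iexp (s * X x))" for x
    \<comment> \<open>As \<open>c\<close> has modulus 1, \<open>f\<close> takes values in [-1, 1],
      and adding 2 makes the weight positive. The contribution of the constant is subtracted again
      at the end.\<close>
    define g where "g x = 2 + f x" for x
    have [measurable]: "f \<in> borel_measurable M" unfolding f_def by measurable
    have bd: "\<bar>f x\<bar> \<le> 1" for x
      using abs_Re_le_cmod[of "c * iexp (s * X x)"] c unfolding f_def by (simp only: norm_mult norm_exp_i_times)
    have re: "complex_of_real (g x) = 2 + c / 2 * iexp (s * X x) + cnj c / 2 * iexp (- s * X x)" for x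
      using re[of c "s * X x"] unfolding g_def f_def by simp
    have iR: "integrable M f"
      by (intro integrable_const_bound[of _ 1] AE_I2) (use bd in auto)
    have iRA: "integrable M (\<lambda>x. f x * indicator A (Y x))"
      by (intro integrable_const_bound[of _ 1] AE_I2) (use bd in \<open>auto split: split_indicator\<close>)
    have ig: "integrable M g" unfolding g_def using iR by simp
    have nn: "0 \<le> g x" for x using bd[of x] unfolding g_def by linarith
    have E: "complex_of_real (expectation g)
        = 2 + c / 2 * (CLINT x|M. iexp (s * X x)) + cnj c / 2 * (CLINT x|M. iexp (- s * X x))"
    proof -
      have "complex_of_real (expectation g) = (CLINT x|M. 2 + c / 2 * iexp (s * X x) + cnj c / 2 * iexp (- s * X x))"
        unfolding integral_complex_of_real[symmetric] re by simp
      also have "\<dots> = (CLINT x|M. 2) + c / 2 * (CLINT x|M. iexp (s * X x)) + cnj c / 2 * (CLINT x|M. iexp (- s * X x))"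
        using int(1)[of s] int(1)[of "-s"]
        by (subst Bochner_Integration.integral_add, simp, simp, subst Bochner_Integration.integral_add)
           (simp_all only: integral_mult_right_zero integrable_mult_right integrable_const)
      finally show ?thesis by (simp add: prob_space)
    qed
    have "expectation (\<lambda>x. g x * indicator A (Y x)) = expectation g * prob (Y -` A \<inter> space M)"
    proof (rule expectation_indicator_of_char[OF Y ig nn _ A])
      fix t
      let ?i = "\<lambda>s x. iexp (s * X x) * iexp (t * Y x)"
      have "(CLINT x|M. complex_of_real (g x) * iexp (t * Y x))
          = (CLINT x|M. 2 * iexp (t * Y x) + c / 2 * ?i s x + cnj c / 2 * ?i (- s) x)"
        unfolding re by (intro Bochner_Integration.integral_cong) (simp_all add: algebra_simps)
      also have "\<dots> = 2 * (CLINT x|M. iexp (t * Y x)) + c / 2 * (CLINT x|M. ?i s x) + cnj c / 2 * (CLINT x|M. ?i (- s) x)"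
        using int(3)[of s t] int(3)[of "-s" t] int(2)[of t]
        by (subst Bochner_Integration.integral_add, simp, simp, subst Bochner_Integration.integral_add)
           (simp_all only: integral_mult_right_zero integrable_mult_right)
      also have "\<dots> = complex_of_real (expectation g) * (CLINT x|M. iexp (t * Y x))"
        unfolding E char' by (simp add: algebra_simps)
      finally show "(CLINT x|M. complex_of_real (g x) * iexp (t * Y x))
          = complex_of_real (expectation g) * (CLINT x|M. iexp (t * Y x))" .
    qed
    moreover have "expectation (\<lambda>x. g x * indicator A (Y x))
        = 2 * prob (Y -` A \<inter> space M) + expectation (\<lambda>x. f x * indicator A (Y x))"
    proof -
      have "(\<lambda>x. indicator A (Y x) :: real) = indicator (Y -` A)" by (auto split: split_indicator)
      then have "expectation (\<lambda>x. indicator A (Y x)) = prob (Y -` A \<inter> space M)" by simp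
      moreover have "integrable M (\<lambda>x. indicator A (Y x) :: real)"
        by (intro integrable_const_bound[of _ 1]) (auto split: split_indicator)
      ultimately show ?thesis unfolding g_def distrib_right
        by (subst Bochner_Integration.integral_add) (use iRA in auto)
    qed
    moreover have "expectation g = 2 + expectation f"
      unfolding g_def by (subst Bochner_Integration.integral_add) (use iR in \<open>auto simp: prob_space\<close>)
    ultimately have "expectation (\<lambda>x. f x * indicator A (Y x)) = expectation f * prob (Y -` A \<inter> space M)"
      by (simp add: distrib_right)
    then show ?thesis unfolding f_def .
  qed
  have cond: "(CLINT x|M. complex_of_real (indicator A (Y x)) * iexp (s * X x))
      = complex_of_real (prob (Y -` A \<inter> space M)) * (CLINT x|M. iexp (s * X x))"
    if A[measurable]: "A \<in> sets borel" for A s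
  proof -
    have i: "integrable M (\<lambda>x. complex_of_real (indicator A (Y x)) * iexp (s * X x))"
      by (intro integrable_const_bound[of _ 1]) (auto simp: norm_mult split: split_indicator)
    have proj: "Re (c * (CLINT x|M. complex_of_real (indicator A (Y x)) * iexp (s * X x)))
        = Re (c * (CLINT x|M. iexp (s * X x))) * prob (Y -` A \<inter> space M)" if "norm c = 1" for c
    proof -
      have l: "bounded_linear (\<lambda>z. Re (c * z))"
        by (rule bounded_linear_compose[OF bounded_linear_Re bounded_linear_mult_right])
      have "Re (c * (CLINT x|M. complex_of_real (indicator A (Y x)) * iexp (s * X x)))
          = expectation (\<lambda>x. Re (c * (complex_of_real (indicator A (Y x)) * iexp (s * X x))))"
        by (rule integral_bounded_linear[OF l i, symmetric])
      also have "\<dots> = expectation (\<lambda>x. Re (c * iexp (s * X x)) * indicator A (Y x))"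
        by (intro Bochner_Integration.integral_cong) (auto split: split_indicator)
      also have "\<dots> = expectation (\<lambda>x. Re (c * iexp (s * X x))) * prob (Y -` A \<inter> space M)"
        by (rule tilt[OF that A])
      also have "expectation (\<lambda>x. Re (c * iexp (s * X x))) = Re (c * (CLINT x|M. iexp (s * X x)))"
        by (rule integral_bounded_linear[OF l int(1)])
      finally show ?thesis .
    qed
    \<comment> \<open>The factor 1 extracts the real part and the factor \<open>- \<i>\<close> the
      imaginary part.\<close>
    show ?thesis
    proof (rule complex_eqI)
    qed (use proj[of 1] proj[of "- \<i>"] in \<open>simp_all add: mult.commute\<close>)
  qed
  show ?thesis
    unfolding indep_var_iff_indep_vectors indep_vectors_iff
  proof (intro conjI X Y ballI)
    fix A B :: "real set" assume A[measurable]: "A \<in> sets borel" and B[measurable]: "B \<in> sets borel"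
    have eB: "expectation (\<lambda>x. indicator B (Y x)) = prob (Y -` B \<inter> space M)"
    proof -
      have "(\<lambda>x. indicator B (Y x) :: real) = indicator (Y -` B)" by (auto split: split_indicator)
      then show ?thesis by simp
    qed
    \<comment> \<open>The roles are exchanged: the weight is now the indicator of \<open>Y\<close>
      lying in \<open>B\<close>, and \<open>cond\<close> supplies its factorised characteristic
      integral against \<open>X\<close>.\<close>
    have "expectation (\<lambda>x. indicator B (Y x) * indicator A (X x))
        = expectation (\<lambda>x. indicator B (Y x)) * prob (X -` A \<inter> space M)"
    proof (rule expectation_indicator_of_char[OF X _ _ _ A])
      show "integrable M (\<lambda>x. indicator B (Y x) :: real)"
        by (intro integrable_const_bound[of _ 1]) (auto split: split_indicator)
    qed (use cond[OF B] in \<open>auto simp: eB\<close>)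
    moreover have "(\<lambda>x. indicator B (Y x) * indicator A (X x) :: real) = indicator (X -` A \<inter> Y -` B)"
      by (auto split: split_indicator)
    moreover have "X -` A \<inter> Y -` B \<inter> space M = X -` A \<inter> space M \<inter> (Y -` B \<inter> space M)" by auto
    ultimately show "prob (X -` A \<inter> space M \<inter> (Y -` B \<inter> space M))
        = prob (X -` A \<inter> space M) * prob (Y -` B \<inter> space M)"
      using eB by simp
  qed
qed

text \<open>Every combination \<open>s * X + t * Y\<close> is normal, so its characteristic function
  is determined by mean and variance. Zero covariance removes the mixed term of the variance, and
  the exponential of the remaining sum factorises.\<close>

theorem indep_var_of_gaussian_uncorrelated:
  fixes X Y :: "'a \<Rightarrow> real"
  assumes g: "gaussian M (\<lambda>x. (X x, Y x))"
    and cov: "expectation (\<lambda>x. (X x - expectation X) * (Y x - expectation Y)) = 0"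
  shows "indep_var borel X borel Y"
proof -
  have comb: "gaussian M (\<lambda>x. s * X x + t * Y x)" for s t
    using g unfolding gaussian_iff_inner[of "\<lambda>x. (X x, Y x)"] by (elim conjE allE[of _ "(s, t)"]) simp
  have gX: "gaussian M X" and gY: "gaussian M Y"
    using comb[of 1 0] comb[of 0 1] by simp_all
  have X[measurable]: "X \<in> borel_measurable M" and Y[measurable]: "Y \<in> borel_measurable M"
    using gX gY by (auto simp: gaussian_def)
  have sX: "integrable M (\<lambda>x. (X x)\<^sup>2)" and sY: "integrable M (\<lambda>x. (Y x)\<^sup>2)"
    using gX[THEN gaussian_integrable_norm_power2] gY[THEN gaussian_integrable_norm_power2] by simp_all
  have iX: "integrable M X" and iY: "integrable M Y"
    using square_integrable_imp_integrable[OF X] square_integrable_imp_integrable[OF Y] sX sY by auto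
  let ?X = "\<lambda>x. X x - expectation X" and ?Y = "\<lambda>x. Y x - expectation Y"
  have cX: "integrable M (\<lambda>x. (?X x)\<^sup>2)" and cY: "integrable M (\<lambda>x. (?Y x)\<^sup>2)"
    using sX sY iX iY by (simp_all add: power2_diff)
  have cXY: "integrable M (\<lambda>x. ?X x * ?Y x)"
  proof (rule Bochner_Integration.integrable_bound)
    show "integrable M (\<lambda>x. (?X x)\<^sup>2 + (?Y x)\<^sup>2)" using cX cY by simp
    have "\<bar>a * b\<bar> \<le> a\<^sup>2 + b\<^sup>2" for a b :: real
      using sum_squares_bound[of "\<bar>a\<bar>" "\<bar>b\<bar>"] mult_nonneg_nonneg[of "\<bar>a\<bar>" "\<bar>b\<bar>"]
      unfolding abs_mult power2_abs mult.assoc by linarith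
    then show "AE x in M. norm (?X x * ?Y x) \<le> norm ((?X x)\<^sup>2 + (?Y x)\<^sup>2)" by simp
  qed auto
  show ?thesis
  proof (rule indep_var_of_char[OF X Y])
    fix s t :: real
    let ?W = "\<lambda>x. s * X x + t * Y x"
    have E: "expectation ?W = s * expectation X + t * expectation Y" using iX iY by simp
    have "variance ?W = expectation (\<lambda>x. s\<^sup>2 * (?X x)\<^sup>2 + t\<^sup>2 * (?Y x)\<^sup>2 + 2 * s * t * (?X x * ?Y x))"
      unfolding E by (intro Bochner_Integration.integral_cong) (auto simp: power2_eq_square algebra_simps)
    also have "\<dots> = s\<^sup>2 * variance X + t\<^sup>2 * variance Y"
      using cX cY cXY cov by simp
    finally have V: "variance ?W = s\<^sup>2 * variance X + t\<^sup>2 * variance Y" .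
    have ch: "(CLINT x|M. iexp (r * W x))
        = iexp (r * expectation W) * complex_of_real (exp (- (r\<^sup>2 * variance W) / 2))"
      if "gaussian M W" for r and W :: "'a \<Rightarrow> real"
    proof -
      have [measurable]: "W \<in> borel_measurable M" using that by (simp add: gaussian_def)
      show ?thesis using char_gaussian[OF that, of r] by (simp add: char_def integral_distr)
    qed
    have e: "exp (- (v + w) / 2) = exp (- v / 2) * exp (- w / 2)" for v w :: real
      by (simp add: exp_add[symmetric] field_simps)
    \<comment> \<open>The joint characteristic function at \<open>(s, t)\<close> is that of the
      single variable \<open>s * X + t * Y\<close> at 1.\<close>
    show "(CLINT x|M. iexp (s * X x + t * Y x)) = (CLINT x|M. iexp (s * X x)) * (CLINT x|M. iexp (t * Y x))"
      using ch[OF comb[of s t], of 1] unfolding ch[OF gX] ch[OF gY] V unfolding E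
      by (simp only: mult_1 one_power2 e of_real_mult of_real_add distrib_left exp_add mult_ac)
  qed
qed

end


section \<open>Conditional entropy and conditional expectation under an independent shift\<close>

lemma borel_measurable_vec1[measurable]: "(vec :: real \<Rightarrow> real^1) \<in> borel_measurable borel"
  by (intro borel_measurable_continuous_onI linear_continuous_on linear_conv_bounded_linear[THEN iffD1])
    (simp add: linear_vec)

text \<open>Outputs take values in \<open>real^1\<close>, while normal densities live on
  \<open>real\<close>. A box in \<open>real^1\<close> pulls back under \<open>vec\<close> to an
  interval, whose length is the only factor of the product over \<open>Basis\<close>.\<close>

lemma lborel_vec1_eq: "(lborel :: (real^1) measure) = distr lborel borel vec"
proof (rule lborel_eqI)
  fix l u :: "real^1" assume le: "\<And>b. b \<in> Basis \<Longrightarrow> l \<bullet> b \<le> u \<bullet> b"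
  have B: "Basis = {axis 1 1 :: real^1}" by (auto simp: Basis_vec_def)
  have "vec -` box l u = {l $ 1 <..< u $ 1}" by (auto simp: box_def B inner_axis)
  moreover have "l $ 1 \<le> u $ 1" using le[of "axis 1 1"] by (simp add: B inner_axis)
  ultimately show "emeasure (distr lborel borel vec) (box l u) = (\<Prod>b\<in>Basis. (u - l) \<bullet> b)"
    by (simp add: emeasure_distr B inner_axis)
qed simp

lemma borel_measurable_component_cart[measurable]: "(\<lambda>v :: real^'n. v $ i) \<in> borel_measurable borel"
  by (intro borel_measurable_continuous_onI continuous_intros)

lemma (in prob_space) distributed_vec1:
  fixes V :: "'a \<Rightarrow> real^1" and f :: "real \<Rightarrow> ennreal"
  assumes D: "distributed M lborel (\<lambda>x. V x $ 1) f"
  shows "distributed M lborel V (\<lambda>v. f (v $ 1))"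
proof -
  have [measurable]: "f \<in> borel_measurable borel" and [measurable]: "(\<lambda>x. V x $ 1) \<in> borel_measurable M"
    using D by (auto simp: distributed_def)
  have V: "V = (\<lambda>x. vec (V x $ 1))" by (auto simp: vec_eq_iff)
  have "distr M lborel V = distr (distr M lborel (\<lambda>x. V x $ 1)) borel vec"
    by (subst V, subst distr_distr) (auto intro!: distr_cong simp: comp_def)
  also have "\<dots> = distr (density lborel f) borel vec" using D by (simp add: distributed_def)
  also have "\<dots> = density (distr lborel borel vec) (\<lambda>v. f (v $ 1))"
    by (subst density_distr) auto
  finally have "distr M lborel V = density lborel (\<lambda>v. f (v $ 1))" unfolding lborel_vec1_eq .
  moreover have "V \<in> borel_measurable M" by (subst V) measurable
  ultimately show ?thesis by (simp add: distributed_def)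
qed

text \<open>Transport along \<open>vec\<close> turns the entropy integral over \<open>real^1\<close>
  into the one over \<open>real\<close>, so the vector has the entropy of its only
  coordinate.\<close>

lemma (in information_space) entropy_normal_vec1:
  fixes V :: "'a \<Rightarrow> real^1"
  assumes D: "distributed M lborel (\<lambda>x. V x $ 1) (normal_density \<mu> \<sigma>)" and \<sigma>: "0 < \<sigma>"
  shows "entropy b lborel V = log b (2 * pi * exp 1 * \<sigma>\<^sup>2) / 2"
proof -
  let ?f = "normal_density \<mu> \<sigma>"
  have "entropy b lborel V = - (\<integral>v. ?f (v $ 1) * log b (?f (v $ 1)) \<partial>(lborel :: (real^1) measure))"
    by (rule entropy_distr[OF distributed_vec1[OF D]]) simp
  also have "\<dots> = - (\<integral>x. ?f x * log b (?f x) \<partial>lborel)"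
    unfolding lborel_vec1_eq by (subst integral_distr) auto
  also have "\<dots> = entropy b lborel (\<lambda>x. V x $ 1)"
    by (rule entropy_distr[OF D, symmetric]) simp
  finally show ?thesis using entropy_normal_density[OF \<sigma> D] by simp
qed

text \<open>For fixed \<open>y\<close> the map acts on the first coordinate as a translation, which
  preserves Lebesgue measure; by Tonelli the whole map preserves it as well. So no Jacobian appears,
  and \<open>h\<close> may be any Borel function.\<close>

lemma (in prob_space) distributed_shear:
  fixes V :: "'a \<Rightarrow> 'b::euclidean_space" and Y :: "'a \<Rightarrow> 'c::euclidean_space"
    and f :: "'b \<Rightarrow> real" and g :: "'c \<Rightarrow> real" and h :: "'c \<Rightarrow> 'b"
  assumes V: "distributed M lborel V f" and Y: "distributed M lborel Y g"
    and f: "\<And>v. 0 \<le> f v" and g: "\<And>y. 0 \<le> g y"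
    and [measurable]: "h \<in> borel_measurable borel"
    and joint: "distributed M (lborel \<Otimes>\<^sub>M lborel) (\<lambda>x. (V x, Y x)) (\<lambda>(v, y). ennreal (f v) * ennreal (g y))"
  shows "distributed M (lborel \<Otimes>\<^sub>M lborel) (\<lambda>x. (V x + h (Y x), Y x)) (\<lambda>p. f (fst p - h (snd p)) * g (snd p))"
proof -
  have [measurable]: "f \<in> borel_measurable borel" "g \<in> borel_measurable borel"
    using distributed_real_measurable[OF _ V] distributed_real_measurable[OF _ Y] f g by auto
  have [measurable]: "V \<in> borel_measurable M" "Y \<in> borel_measurable M"
    using V Y by (auto simp: distributed_def)
  let ?P = "lborel \<Otimes>\<^sub>M lborel :: ('b \<times> 'c) measure"
  let ?T = "\<lambda>(v, y). (v + h y, y)"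
  have D: "distr M ?P (\<lambda>x. (V x, Y x)) = density ?P (\<lambda>(v, y). ennreal (f v) * ennreal (g y))"
    using joint by (simp add: distributed_def)
  have "distr M ?P (\<lambda>x. (V x + h (Y x), Y x)) = distr (distr M ?P (\<lambda>x. (V x, Y x))) ?P ?T"
    by (subst distr_distr) (auto simp: comp_def)
  also have "\<dots> = density ?P (\<lambda>p. ennreal (f (fst p - h (snd p)) * g (snd p)))"
    unfolding D
  proof (rule measure_eqI)
    fix S assume "S \<in> sets (distr (density ?P (\<lambda>(v, y). ennreal (f v) * ennreal (g y))) ?P ?T)"
    then have S: "S \<in> sets ?P" by simp
    note [measurable] = this
    have "emeasure (distr (density ?P (\<lambda>(v, y). ennreal (f v) * ennreal (g y))) ?P ?T) S
        = (\<integral>\<^sup>+q. indicator S q \<partial>distr (density ?P (\<lambda>(v, y). ennreal (f v) * ennreal (g y))) ?P ?T)"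
      by (rule nn_integral_indicator[symmetric]) (use S in simp)
    also have "\<dots> = (\<integral>\<^sup>+p. indicator S (?T p) \<partial>density ?P (\<lambda>(v, y). ennreal (f v) * ennreal (g y)))"
      by (subst nn_integral_distr) auto
    also have "\<dots> = (\<integral>\<^sup>+p. (case p of (v, y) \<Rightarrow> ennreal (f v) * ennreal (g y)) * indicator S (?T p) \<partial>?P)"
      by (subst nn_integral_density) auto
    \<comment> \<open>The inner integral runs over \<open>v\<close>, so that the shift
      \<open>h y\<close> is constant there.\<close>
    also have "\<dots> = (\<integral>\<^sup>+y. \<integral>\<^sup>+v. ennreal (f v) * ennreal (g y) * indicator S (v + h y, y) \<partial>lborel \<partial>lborel)"
      by (subst lborel_pair.nn_integral_snd[symmetric]) auto
    also have "\<dots> = (\<integral>\<^sup>+y. \<integral>\<^sup>+v. ennreal (f (v - h y)) * ennreal (g y) * indicator S (v, y) \<partial>lborel \<partial>lborel)"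
    proof (rule nn_integral_cong)
      fix y :: 'c
      have "(\<integral>\<^sup>+v. ennreal (f (v - h y)) * ennreal (g y) * indicator S (v, y) \<partial>lborel)
          = (\<integral>\<^sup>+v. ennreal (f (v - h y)) * ennreal (g y) * indicator S (v, y) \<partial>distr lborel borel ((+) (h y)))"
        by (simp add: lborel_distr_plus)
      also have "\<dots> = (\<integral>\<^sup>+v. ennreal (f v) * ennreal (g y) * indicator S (v + h y, y) \<partial>lborel)"
        by (subst nn_integral_distr) (auto simp: add.commute)
      finally show "(\<integral>\<^sup>+v. ennreal (f v) * ennreal (g y) * indicator S (v + h y, y) \<partial>lborel)
          = (\<integral>\<^sup>+v. ennreal (f (v - h y)) * ennreal (g y) * indicator S (v, y) \<partial>lborel)" ..
    qed
    also have "\<dots> = (\<integral>\<^sup>+p. ennreal (f (fst p - h (snd p)) * g (snd p)) * indicator S p \<partial>?P)"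
      by (subst lborel_pair.nn_integral_snd[symmetric]) (auto simp: ennreal_mult f g)
    also have "\<dots> = emeasure (density ?P (\<lambda>p. ennreal (f (fst p - h (snd p)) * g (snd p)))) S"
      by (subst emeasure_density) (use S in auto)
    finally show "emeasure (distr (density ?P (\<lambda>(v, y). ennreal (f v) * ennreal (g y))) ?P ?T) S
        = emeasure (density ?P (\<lambda>p. ennreal (f (fst p - h (snd p)) * g (snd p)))) S" .
  qed simp
  finally show ?thesis by (simp add: distributed_def)
qed

text \<open>The conditional density of the shifted vector at \<open>x\<close>, given the value
  \<open>y\<close>, is \<open>f (x - h y)\<close>. At the random point itself the shift cancels and
  \<open>f (V x)\<close> is left, so both sides are minus the expectation of
  \<open>log b (f (V x))\<close>.\<close>

theorem (in information_space) conditional_entropy_indep_shift: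
  fixes V :: "'a \<Rightarrow> 'b::euclidean_space" and Y :: "'a \<Rightarrow> 'c::euclidean_space"
    and f :: "'b \<Rightarrow> real" and g :: "'c \<Rightarrow> real" and h :: "'c \<Rightarrow> 'b"
  assumes V: "distributed M lborel V f" and Y: "distributed M lborel Y g"
    and f: "\<And>v. 0 \<le> f v" and g: "\<And>y. 0 \<le> g y"
    and h[measurable]: "h \<in> borel_measurable borel"
    and joint: "distributed M (lborel \<Otimes>\<^sub>M lborel) (\<lambda>x. (V x, Y x)) (\<lambda>(v, y). ennreal (f v) * ennreal (g y))"
  shows "conditional_entropy b lborel lborel (\<lambda>x. V x + h (Y x)) Y = entropy b lborel V"
proof -
  have [measurable]: "f \<in> borel_measurable borel" "g \<in> borel_measurable borel"
    using distributed_real_measurable[OF _ V] distributed_real_measurable[OF _ Y] f g by auto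
  have [measurable]: "V \<in> borel_measurable M" "Y \<in> borel_measurable M"
    using V Y by (auto simp: distributed_def)
  let ?p = "\<lambda>p. f (fst p - h (snd p)) * g (snd p)"
  have XY: "distributed M (lborel \<Otimes>\<^sub>M lborel) (\<lambda>x. (V x + h (Y x), Y x)) ?p"
    by (rule distributed_shear[OF V Y f g h joint])
  \<comment> \<open>The factor \<open>g (Y x)\<close> cancels from the quotient only where it is
    nonzero. The zero set of the density is null for the law of \<open>Y\<close>.\<close>
  have "AE y in distr M lborel Y. g y \<noteq> 0"
    unfolding distributed_distr_eq_density[OF Y] by (subst AE_density) auto
  then have gY: "AE x in M. g (Y x) \<noteq> 0" by (subst (asm) AE_distr_iff) auto
  have "conditional_entropy b lborel lborel (\<lambda>x. V x + h (Y x)) Y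
      = - (\<integral>(x, y). ?p (x, y) * log b (?p (x, y) / g y) \<partial>(lborel \<Otimes>\<^sub>M lborel))"
    by (rule conditional_entropy_generic_eq[OF sigma_finite_lborel sigma_finite_lborel Y g XY])
      (simp add: f g)
  also have "(\<lambda>(x, y). ?p (x, y) * log b (?p (x, y) / g y)) = (\<lambda>q. ?p q * log b (?p q / g (snd q)))"
    by auto
  also have "(\<integral>q. ?p q * log b (?p q / g (snd q)) \<partial>(lborel \<Otimes>\<^sub>M lborel))
      = (\<integral>x. log b (?p (V x + h (Y x), Y x) / g (snd (V x + h (Y x), Y x))) \<partial>M)"
    by (rule distributed_integral[OF XY]) (auto simp: f g)
  also have "\<dots> = (\<integral>x. log b (f (V x)) \<partial>M)"
    using gY by (intro integral_cong_AE) auto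
  also have "\<dots> = (\<integral>v. f v * log b (f v) \<partial>lborel)"
    by (rule distributed_integral[OF V, symmetric]) (auto simp: f)
  also have "- \<dots> = entropy b lborel V" by (rule entropy_distr[OF V f, symmetric])
  finally show ?thesis .
qed

text \<open>The constant has the defining property of the conditional expectation: the indicator of
  an event generated by \<open>Y\<close> is a function of \<open>Y\<close>, and its product with
  \<open>V\<close> has a factorising expectation.\<close>

lemma (in prob_space) real_cond_exp_indep:
  fixes V :: "'a \<Rightarrow> real" and Y :: "'a \<Rightarrow> 'c::euclidean_space"
  assumes ind: "indep_vectors M V Y" and int: "integrable M V"
  shows "AE x in M. real_cond_exp M (vimage_algebra (space M) Y borel) V x = expectation V"
proof -
  have Y[measurable]: "Y \<in> borel_measurable M" using ind by (simp add: indep_vectors_def)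
  let ?F = "vimage_algebra (space M) Y borel"
  have sF: "sets ?F = {Y -` A \<inter> space M |A. A \<in> sets borel}" by (rule sets_vimage_algebra2) auto
  interpret finite_measure_subalgebra M ?F
  proof
    show "subalgebra M ?F"
      unfolding subalgebra_def sF by (auto intro: measurable_sets)
  qed
  show ?thesis
  proof (rule real_cond_exp_charact)
    fix B assume "B \<in> sets ?F"
    then obtain A where A[measurable]: "A \<in> sets borel" and B: "B = Y -` A \<inter> space M" unfolding sF by auto
    have "indep_vectors M V (\<lambda>x. indicator A (Y x) :: real)"
      using indep_vectors_comp[OF ind, of "\<lambda>v. v" "indicator A :: 'c \<Rightarrow> real"] by simp
    then have i: "indep_var borel V borel (\<lambda>x. indicator A (Y x) :: real)"
      by (simp add: indep_var_iff_indep_vectors)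
    have iA: "integrable M (\<lambda>x. indicator A (Y x) :: real)"
      by (intro integrable_const_bound[of _ 1]) (auto split: split_indicator)
    have "(\<integral>x\<in>B. V x \<partial>M) = (\<integral>x. V x * indicator A (Y x) \<partial>M)"
      unfolding set_lebesgue_integral_def B
      by (intro Bochner_Integration.integral_cong) (auto split: split_indicator)
    also have "\<dots> = expectation V * expectation (\<lambda>x. indicator A (Y x))"
      by (rule indep_var_lebesgue_integral[OF i int iA])
    also have "\<dots> = (\<integral>x. expectation V * indicator A (Y x) \<partial>M)" by simp
    also have "\<dots> = (\<integral>x\<in>B. expectation V \<partial>M)"
      unfolding set_lebesgue_integral_def B
      by (intro Bochner_Integration.integral_cong) (auto split: split_indicator)
    finally show "(\<integral>x\<in>B. V x \<partial>M) = (\<integral>x\<in>B. expectation V \<partial>M)" .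
  qed (use int in auto)
qed


section \<open>Covariance matrices\<close>

text \<open>The bilinear form behind \<open>covariance\<close>. Covariances of sums expand into such
  mixed terms, which reduces all second moments of the system to those of state, input and
  noise.\<close>

definition cross_covariance :: "'a measure \<Rightarrow> ('a \<Rightarrow> real^'m) \<Rightarrow> ('a \<Rightarrow> real^'n) \<Rightarrow> real^'n^'m" where
  "cross_covariance M X Y =
     mean_outer M (\<lambda>x. X x - integral\<^sup>L M X) (\<lambda>x. Y x - integral\<^sup>L M Y)"

lemma covariance_eq_cross_covariance: "covariance M X = cross_covariance M X X"
  by (simp add: covariance_def cross_covariance_def)

lemma mean_outer_cong:
  assumes "\<And>x. x \<in> space M \<Longrightarrow> X x = X' x" "\<And>x. x \<in> space M \<Longrightarrow> Y x = Y' x"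
  shows "mean_outer M X Y = mean_outer M X' Y'"
  using assms by (simp add: mean_outer_def vec_eq_iff cong: Bochner_Integration.integral_cong)

lemma cross_covariance_cong:
  assumes X: "\<And>x. x \<in> space M \<Longrightarrow> X x = X' x" and Y: "\<And>x. x \<in> space M \<Longrightarrow> Y x = Y' x"
  shows "cross_covariance M X Y = cross_covariance M X' Y'"
proof -
  have "integral\<^sup>L M X = integral\<^sup>L M X'" "integral\<^sup>L M Y = integral\<^sup>L M Y'"
    using X Y by (auto intro: Bochner_Integration.integral_cong)
  then show ?thesis unfolding cross_covariance_def using X Y by (intro mean_outer_cong) auto
qed

lemma transpose_mean_outer: "transpose (mean_outer M X Y) = mean_outer M Y X"
  by (simp add: mean_outer_def transpose_def vec_eq_iff mult.commute)

lemma transpose_cross_covariance: "transpose (cross_covariance M X Y) = cross_covariance M Y X"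
  by (simp add: cross_covariance_def transpose_mean_outer)

lemma gaussian_cong:
  assumes "\<And>x. x \<in> space M \<Longrightarrow> X x = X' x"
  shows "gaussian M X \<longleftrightarrow> gaussian M X'"
proof -
  have "distr M borel (\<lambda>x. a \<bullet> X x) = distr M borel (\<lambda>x. a \<bullet> X' x)" for a
    using assms by (intro distr_cong) auto
  moreover have "X \<in> borel_measurable M \<longleftrightarrow> X' \<in> borel_measurable M"
    using assms by (intro measurable_cong) auto
  ultimately show ?thesis by (simp add: gaussian_def)
qed

text \<open>Covariance depends on the law alone. This carries \<open>\<Sigma>\<omega>\<close> from
  \<open>\<omega> t\<close> to the identically distributed \<open>\<omega> (Suc t)\<close>.\<close>

lemma covariance_distr:
  assumes [measurable]: "X \<in> borel_measurable M"
  shows "covariance (distr M borel X) (\<lambda>y. y) = covariance M X"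
proof -
  have "integral\<^sup>L (distr M borel X) (\<lambda>y. y) = integral\<^sup>L M X" by (rule integral_distr) auto
  then show ?thesis
    by (simp add: covariance_def mean_outer_def vec_eq_iff integral_distr)
qed

section \<open>Square-integrable vectors and bilinearity of second moments\<close>

definition square_integrable :: "'a measure \<Rightarrow> ('a \<Rightarrow> 'b::euclidean_space) \<Rightarrow> bool" where
  "square_integrable M X \<longleftrightarrow> X \<in> borel_measurable M \<and> integrable M (\<lambda>x. (norm (X x))\<^sup>2)"

lemma square_integrable_measurable[measurable_dest]:
  "square_integrable M X \<Longrightarrow> X \<in> borel_measurable M"
  by (simp add: square_integrable_def)

lemma square_integrable_add:
  assumes X: "square_integrable M X" and Y: "square_integrable M Y"
  shows "square_integrable M (\<lambda>x. X x + Y x)"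
proof -
  note [measurable] = square_integrable_measurable[OF X] square_integrable_measurable[OF Y]
  have "integrable M (\<lambda>x. (norm (X x + Y x))\<^sup>2)"
  proof (rule Bochner_Integration.integrable_bound)
    show "integrable M (\<lambda>x. 2 * (norm (X x))\<^sup>2 + 2 * (norm (Y x))\<^sup>2)"
      using X Y by (simp add: square_integrable_def)
    have "(norm (a + b))\<^sup>2 \<le> 2 * (norm a)\<^sup>2 + 2 * (norm b)\<^sup>2" for a b :: 'b
    proof -
      have "(norm (a + b))\<^sup>2 \<le> (norm a + norm b)\<^sup>2" by (simp add: norm_triangle_ineq power_mono)
      also have "\<dots> \<le> 2 * (norm a)\<^sup>2 + 2 * (norm b)\<^sup>2"
        using sum_squares_bound[of "norm a" "norm b"] by (simp add: power2_sum)
      finally show ?thesis .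
    qed
    then show "AE x in M. norm ((norm (X x + Y x))\<^sup>2) \<le> norm (2 * (norm (X x))\<^sup>2 + 2 * (norm (Y x))\<^sup>2)"
      by simp
  qed measurable
  then show ?thesis by (simp add: square_integrable_def)
qed

lemma square_integrable_linear:
  assumes X: "square_integrable M X" and L: "linear L"
  shows "square_integrable M (\<lambda>x. L (X x))"
proof -
  note [measurable] = square_integrable_measurable[OF X]
  have bl: "bounded_linear L" using L by (simp add: linear_conv_bounded_linear)
  then have [measurable]: "L \<in> borel_measurable borel"
    by (intro borel_measurable_continuous_onI linear_continuous_on)
  obtain c where c: "\<And>y. norm (L y) \<le> norm y * c" using bounded_linear.bounded[OF bl] by blast
  have "integrable M (\<lambda>x. (norm (L (X x)))\<^sup>2)"
  proof (rule Bochner_Integration.integrable_bound)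
    show "integrable M (\<lambda>x. (norm (X x))\<^sup>2 * c\<^sup>2)" using X by (simp add: square_integrable_def)
    show "AE x in M. norm ((norm (L (X x)))\<^sup>2) \<le> norm ((norm (X x))\<^sup>2 * c\<^sup>2)"
      using power_mono[OF c norm_ge_zero, of _ 2] by (simp add: power_mult_distrib)
  qed measurable
  then show ?thesis by (simp add: square_integrable_def)
qed

text \<open>Coordinates are bounded by the norm, and a product of norms by the sum of their squares.
  So the entries of \<open>mean_outer\<close> are genuine expectations and not the default value 0
  of a non-integrable function.\<close>

lemma square_integrable_nth_mult:
  fixes X :: "'a \<Rightarrow> real^'m" and Y :: "'a \<Rightarrow> real^'n"
  assumes X: "square_integrable M X" and Y: "square_integrable M Y"
  shows "integrable M (\<lambda>x. X x $ i * Y x $ j)"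
proof (rule Bochner_Integration.integrable_bound)
  note [measurable] = square_integrable_measurable[OF X] square_integrable_measurable[OF Y]
  show "(\<lambda>x. X x $ i * Y x $ j) \<in> borel_measurable M" by measurable
  show "integrable M (\<lambda>x. (norm (X x))\<^sup>2 + (norm (Y x))\<^sup>2)"
    using X Y by (simp add: square_integrable_def)
  have "\<bar>a $ i * b $ j\<bar> \<le> (norm a)\<^sup>2 + (norm b)\<^sup>2" for a :: "real^'m" and b :: "real^'n"
  proof -
    have "\<bar>a $ i * b $ j\<bar> \<le> norm a * norm b"
      unfolding abs_mult by (intro mult_mono component_le_norm_cart) auto
    also have "\<dots> \<le> (norm a)\<^sup>2 + (norm b)\<^sup>2"
      using sum_squares_bound[of "norm a" "norm b"] mult_nonneg_nonneg[OF norm_ge_zero norm_ge_zero, of a b]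
      unfolding mult.assoc by linarith
    finally show ?thesis .
  qed
  then show "AE x in M. norm (X x $ i * Y x $ j) \<le> norm ((norm (X x))\<^sup>2 + (norm (Y x))\<^sup>2)"
    by simp
qed

lemma mean_outer_add_left:
  assumes "square_integrable M X" "square_integrable M X'" "square_integrable M Y"
  shows "mean_outer M (\<lambda>x. X x + X' x) Y = mean_outer M X Y + mean_outer M X' Y"
  using assms by (simp add: mean_outer_def vec_eq_iff distrib_right square_integrable_nth_mult)

lemma mean_outer_mult_left:
  assumes "square_integrable M X" "square_integrable M Y"
  shows "mean_outer M (\<lambda>x. G *v X x) Y = G ** mean_outer M X Y"
proof -
  have "(\<integral>x. (\<Sum>k\<in>UNIV. G $ i $ k * X x $ k) * Y x $ j \<partial>M)
      = (\<Sum>k\<in>UNIV. G $ i $ k * (\<integral>x. X x $ k * Y x $ j \<partial>M))" for i j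
    unfolding sum_distrib_right mult.assoc
    by (subst Bochner_Integration.integral_sum) (use assms in \<open>auto simp: square_integrable_nth_mult\<close>)
  then show ?thesis
    by (simp add: mean_outer_def vec_eq_iff matrix_vector_mult_def matrix_matrix_mult_def)
qed

context prob_space
begin

lemma square_integrable_const: "square_integrable M (\<lambda>_. c)"
  by (simp add: square_integrable_def)

lemma square_integrable_integrable:
  assumes X: "square_integrable M X"
  shows "integrable M X"
proof (rule Bochner_Integration.integrable_bound)
  show "X \<in> borel_measurable M" by (rule square_integrable_measurable[OF X])
  show "integrable M (\<lambda>x. 1 + (norm (X x))\<^sup>2)" using X by (simp add: square_integrable_def)
  have "r \<le> 1 + r\<^sup>2" for r :: real using sum_squares_bound[of r 1] zero_le_power2[of r]
    unfolding mult_1_right one_power2 by linarith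
  then show "AE x in M. norm (X x) \<le> norm (1 + (norm (X x))\<^sup>2)" by simp
qed

lemma square_integrable_centered:
  assumes "square_integrable M X"
  shows "square_integrable M (\<lambda>x. X x - c)"
  using square_integrable_add[OF assms square_integrable_const[of "- c"]] by simp

lemma expectation_vec_nth:
  assumes "integrable M X"
  shows "integral\<^sup>L M X $ i = expectation (\<lambda>x. X x $ i)"
  using integral_bounded_linear[OF bounded_linear_vec_nth assms] by simp

lemma cross_covariance_add_left:
  assumes X: "square_integrable M X" "square_integrable M X'" and Y: "square_integrable M Y"
  shows "cross_covariance M (\<lambda>x. X x + X' x) Y = cross_covariance M X Y + cross_covariance M X' Y"
proof -
  have "(\<lambda>x. X x + X' x - integral\<^sup>L M (\<lambda>x. X x + X' x))
      = (\<lambda>x. (X x - integral\<^sup>L M X) + (X' x - integral\<^sup>L M X'))"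
    using X by (simp add: square_integrable_integrable algebra_simps)
  then show ?thesis unfolding cross_covariance_def
    using X Y by (simp add: mean_outer_add_left square_integrable_centered)
qed

lemma cross_covariance_add_right:
  assumes "square_integrable M X" "square_integrable M Y" "square_integrable M Y'"
  shows "cross_covariance M X (\<lambda>x. Y x + Y' x) = cross_covariance M X Y + cross_covariance M X Y'"
proof -
  have "cross_covariance M X (\<lambda>x. Y x + Y' x) = transpose (cross_covariance M Y X + cross_covariance M Y' X)"
    unfolding cross_covariance_add_left[OF assms(2,3,1), symmetric] transpose_cross_covariance ..
  also have "\<dots> = transpose (cross_covariance M Y X) + transpose (cross_covariance M Y' X)"
    by (simp add: transpose_def vec_eq_iff)
  finally show ?thesis unfolding transpose_cross_covariance .
qed

lemma cross_covariance_mult_left: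
  assumes X: "square_integrable M X" and Y: "square_integrable M Y"
  shows "cross_covariance M (\<lambda>x. G *v X x) Y = G ** cross_covariance M X Y"
proof -
  have "integral\<^sup>L M (\<lambda>x. G *v X x) = G *v integral\<^sup>L M X"
    by (rule integral_bounded_linear[OF matrix_vector_mul_bounded_linear square_integrable_integrable[OF X]])
  then show ?thesis unfolding cross_covariance_def
    using X Y by (simp add: mean_outer_mult_left square_integrable_centered matrix_vector_mult_diff_distrib[symmetric])
qed

lemma cross_covariance_mult_right:
  assumes "square_integrable M X" "square_integrable M Y"
  shows "cross_covariance M X (\<lambda>x. G *v Y x) = cross_covariance M X Y ** transpose G"
proof -
  have "cross_covariance M X (\<lambda>x. G *v Y x) = transpose (G ** cross_covariance M Y X)"
    unfolding cross_covariance_mult_left[OF assms(2,1), symmetric] transpose_cross_covariance ..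
  then show ?thesis unfolding matrix_transpose_mul transpose_cross_covariance .
qed

text \<open>The correction between the two matrices is the mean of \<open>X\<close> times the mean
  of \<open>Y\<close>, so one vanishing mean suffices. The state may therefore have any mean when
  its correlation with the input is examined.\<close>

lemma cross_covariance_centered_right:
  assumes X: "square_integrable M X" and Y: "square_integrable M Y" and 0: "integral\<^sup>L M Y = 0"
  shows "cross_covariance M X Y = mean_outer M X Y"
proof -
  have "expectation (\<lambda>x. Y x $ j) = 0" for j
    unfolding expectation_vec_nth[OF square_integrable_integrable[OF Y], symmetric] 0 by simp
  moreover have "integrable M (\<lambda>x. Y x $ j)" for j
    by (rule integrable_bounded_linear[OF bounded_linear_vec_nth square_integrable_integrable[OF Y]])
  ultimately show ?thesis
    using X Y by (simp add: cross_covariance_def 0 mean_outer_def vec_eq_iff left_diff_distrib square_integrable_nth_mult)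
qed

lemma cross_covariance_indep_vectors:
  assumes ind: "indep_vectors M X Y" and X: "square_integrable M X" and Y: "square_integrable M Y"
  shows "cross_covariance M X Y = 0"
proof -
  have zero: "expectation (\<lambda>x. (Z x - integral\<^sup>L M Z) $ i) = 0" and int: "integrable M (\<lambda>x. (Z x - integral\<^sup>L M Z) $ i)"
    if "square_integrable M Z" for Z :: "'a \<Rightarrow> real^'k" and i
  proof -
    note Z = square_integrable_integrable[OF that]
    have i: "integrable M (\<lambda>x. Z x $ i)" by (rule integrable_bounded_linear[OF bounded_linear_vec_nth Z])
    then show "integrable M (\<lambda>x. (Z x - integral\<^sup>L M Z) $ i)" by simp
    show "expectation (\<lambda>x. (Z x - integral\<^sup>L M Z) $ i) = 0"
      using i expectation_vec_nth[OF Z, of i] by (simp add: prob_space)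
  qed
  have "expectation (\<lambda>x. (X x - integral\<^sup>L M X) $ i * (Y x - integral\<^sup>L M Y) $ j) = 0" for i j
  proof -
    have "indep_vectors M (\<lambda>x. (X x - integral\<^sup>L M X) $ i) (\<lambda>x. (Y x - integral\<^sup>L M Y) $ j)"
      by (rule indep_vectors_comp[OF ind, of "\<lambda>v. (v - integral\<^sup>L M X) $ i" "\<lambda>v. (v - integral\<^sup>L M Y) $ j"])
        (intro borel_measurable_continuous_onI continuous_intros)+
    then have "indep_var borel (\<lambda>x. (X x - integral\<^sup>L M X) $ i) borel (\<lambda>x. (Y x - integral\<^sup>L M Y) $ j)"
      by (simp only: indep_var_iff_indep_vectors)
    from indep_var_lebesgue_integral[OF this int[OF X] int[OF Y]] show ?thesis
      unfolding zero[OF X] by simp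
  qed
  then show ?thesis by (simp add: cross_covariance_def mean_outer_def vec_eq_iff)
qed

lemma covariance_add_const:
  assumes "integrable M X"
  shows "covariance M (\<lambda>x. c + X x) = covariance M X"
proof -
  have "integral\<^sup>L M (\<lambda>x. c + X x) = c + integral\<^sup>L M X" using assms by (simp add: prob_space)
  then show ?thesis by (simp add: covariance_def)
qed

lemma covariance_nth_nth:
  assumes "integrable M X"
  shows "covariance M X $ i $ i = variance (\<lambda>x. X x $ i)"
  by (simp add: covariance_def mean_outer_def expectation_vec_nth[OF assms] power2_eq_square)

lemma covariance_diag_nonneg: "0 \<le> covariance M X $ i $ i"
  by (simp add: covariance_def mean_outer_def)

lemma gaussian_square_integrable: "gaussian M X \<Longrightarrow> square_integrable M X"
  by (simp add: square_integrable_def gaussian_integrable_norm_power2 gaussian_def)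

lemma gaussian_const: "gaussian M (\<lambda>_. c)"
proof -
  have "distr M borel (\<lambda>_. a \<bullet> c) = normal_measure (a \<bullet> c) 0" for a
    by (simp add: normal_measure_def)
  then show ?thesis unfolding gaussian_def by (intro conjI allI exI[of _ "_ \<bullet> c"] exI[of _ 0]) auto
qed

lemma indep_vectors_const_left:
  assumes "Y \<in> borel_measurable M"
  shows "indep_vectors M (\<lambda>_. c) Y"
  using assms by (auto simp: indep_vectors_iff prob_space vimage_def)

lemma indep_vectors_add_const_right:
  assumes "indep_vectors M X Y"
  shows "indep_vectors M X (\<lambda>x. c + Y x)"
  using indep_vectors_comp[OF assms, of "\<lambda>v. v" "\<lambda>y. c + y"] by simp

text \<open>The conditional mean is \<open>h (Y x)\<close> plus the mean of \<open>V\<close>, so the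
  residual is the centred \<open>V\<close>. Its entry products are functions of \<open>V\<close>,
  hence independent of \<open>Y\<close>, and conditioning replaces them by their
  expectations.\<close>

theorem cond_covariance_indep_shift:
  fixes V :: "'a \<Rightarrow> real^'m" and Y :: "'a \<Rightarrow> real^'n"
  assumes ind: "indep_vectors M V Y" and V: "square_integrable M V"
    and h[measurable]: "h \<in> borel_measurable borel" and hY: "integrable M (\<lambda>x. h (Y x))"
  shows "AE x in M. cond_covariance M (\<lambda>x. V x + h (Y x)) Y x = covariance M V"
proof -
  note [measurable] = square_integrable_measurable[OF V]
  have [measurable]: "Y \<in> borel_measurable M" using ind by (simp add: indep_vectors_def)
  let ?F = "vimage_algebra (space M) Y borel"
  let ?X = "\<lambda>x. V x + h (Y x)"
  let ?m = "integral\<^sup>L M V"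
  interpret finite_measure_subalgebra M ?F
  proof
    show "subalgebra M ?F"
      unfolding subalgebra_def by (auto simp: sets_vimage_algebra2 intro: measurable_sets)
  qed
  have [measurable]: "Y \<in> borel_measurable ?F" by (rule measurable_vimage_algebra1) auto
  have iV: "integrable M (\<lambda>x. V x $ i)" for i
    by (rule integrable_bounded_linear[OF bounded_linear_vec_nth square_integrable_integrable[OF V]])
  have ih: "integrable M (\<lambda>x. h (Y x) $ i)" for i
    by (rule integrable_bounded_linear[OF bounded_linear_vec_nth hY])
  have "AE x in M. cond_mean M ?X Y x $ i = ?m $ i + h (Y x) $ i" for i
  proof -
    have "indep_vectors M (\<lambda>x. V x $ i) Y"
      using indep_vectors_comp[OF ind, of "\<lambda>v. v $ i" "\<lambda>y. y"] by simp
    then have "AE x in M. real_cond_exp M ?F (\<lambda>x. V x $ i) x = ?m $ i"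
      unfolding expectation_vec_nth[OF square_integrable_integrable[OF V]]
      by (rule real_cond_exp_indep[OF _ iV])
    moreover have "AE x in M. real_cond_exp M ?F (\<lambda>x. h (Y x) $ i) x = h (Y x) $ i"
      by (rule real_cond_exp_F_meas[OF ih]) measurable
    ultimately show ?thesis
      using real_cond_exp_add[OF iV[of i] ih[of i]] by eventually_elim (simp add: cond_mean_def)
  qed
  then have "AE x in M. \<forall>i. cond_mean M ?X Y x $ i = ?m $ i + h (Y x) $ i"
    by (simp add: AE_all_countable)
  then have mean: "AE x in M. ?X x - cond_mean M ?X Y x = V x - ?m"
    by eventually_elim (simp add: vec_eq_iff)
  have "AE x in M. cond_covariance M ?X Y x $ i $ j = covariance M V $ i $ j" for i j
  proof -
    let ?W = "\<lambda>x. (V x - ?m) $ i * (V x - ?m) $ j"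
    have [measurable]: "(\<lambda>x. cond_mean M ?X Y x $ k) \<in> borel_measurable M" for k
      by (simp add: cond_mean_def)
    have "AE x in M. real_cond_exp M ?F (\<lambda>x. (?X x - cond_mean M ?X Y x) $ i * (?X x - cond_mean M ?X Y x) $ j) x
        = real_cond_exp M ?F ?W x"
    proof (rule real_cond_exp_cong)
      show "AE x in M. (?X x - cond_mean M ?X Y x) $ i * (?X x - cond_mean M ?X Y x) $ j = ?W x"
        using mean by eventually_elim (simp only:)
      show "(\<lambda>x. (?X x - cond_mean M ?X Y x) $ i * (?X x - cond_mean M ?X Y x) $ j) \<in> borel_measurable M"
        unfolding vector_minus_component by measurable
      show "?W \<in> borel_measurable M" by measurable
    qed
    moreover have "AE x in M. real_cond_exp M ?F ?W x = expectation ?W"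
    proof (rule real_cond_exp_indep)
      show "indep_vectors M ?W Y"
        by (rule indep_vectors_comp[OF ind, of "\<lambda>v. (v - ?m) $ i * (v - ?m) $ j" "\<lambda>y. y"])
          (auto intro!: borel_measurable_continuous_onI continuous_intros)
      show "integrable M ?W"
        by (intro square_integrable_nth_mult square_integrable_centered V)
    qed
    ultimately show ?thesis
      by eventually_elim (simp add: cond_covariance_def covariance_def mean_outer_def)
  qed
  then have "AE x in M. \<forall>i j. cond_covariance M ?X Y x $ i $ j = covariance M V $ i $ j"
    by (simp add: AE_all_countable)
  then show ?thesis by eventually_elim (simp add: vec_eq_iff)
qed

end

theorem (in information_space) diff_cond_entropy_indep_gaussian:
  fixes V Y :: "'a \<Rightarrow> real^1"
  assumes ind: "indep_vectors M V Y" and V: "gaussian M V" and Y: "gaussian M Y"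
    and posV: "covariance M V $ 1 $ 1 \<noteq> 0" and posY: "covariance M Y $ 1 $ 1 \<noteq> 0"
    and h: "h \<in> borel_measurable borel"
  shows "diff_cond_entropy b M (\<lambda>x. V x + h (Y x)) Y
    = log b (2 * pi * exp 1 * covariance M V $ 1 $ 1) / 2"
proof -
  have nth: "gaussian M (\<lambda>x. Z x $ 1)" and int: "integrable M Z" if "gaussian M Z" for Z :: "'a \<Rightarrow> real^1"
    using that by (auto intro: gaussian_linear[OF _ bounded_linear.linear[OF bounded_linear_vec_nth]]
        square_integrable_integrable gaussian_square_integrable)
  note var = covariance_nth_nth[OF int[OF V], of 1] and varY = covariance_nth_nth[OF int[OF Y], of 1]
  let ?s = "sqrt (covariance M V $ 1 $ 1)"
  have s: "0 < ?s" using covariance_diag_nonneg[of V 1] posV by simp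
  have D: "distributed M lborel (\<lambda>x. V x $ 1) (normal_density (expectation (\<lambda>x. V x $ 1)) ?s)"
    using gaussian_distributed[OF nth[OF V]] posV unfolding var by simp
  have DY: "distributed M lborel (\<lambda>x. Y x $ 1) (normal_density (expectation (\<lambda>x. Y x $ 1)) (sqrt (covariance M Y $ 1 $ 1)))"
    using gaussian_distributed[OF nth[OF Y]] posY unfolding varY by simp
  note dV = distributed_vec1[OF D] and dY = distributed_vec1[OF DY]
  have "indep_var lborel V lborel Y"
    using ind unfolding indep_var_iff_indep_vectors[symmetric] by (simp add: indep_var_eq)
  from distributed_joint_indep[OF sigma_finite_lborel sigma_finite_lborel dV dY this]
  have "diff_cond_entropy b M (\<lambda>x. V x + h (Y x)) Y = entropy b lborel V"
    unfolding diff_cond_entropy_def by (intro conditional_entropy_indep_shift[OF dV dY _ _ h]) auto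
  also have "\<dots> = log b (2 * pi * exp 1 * ?s\<^sup>2) / 2" by (rule entropy_normal_vec1[OF D s])
  also have "?s\<^sup>2 = covariance M V $ 1 $ 1" using covariance_diag_nonneg by simp
  finally show ?thesis .
qed


section \<open>The linear control system\<close>

lemma indep_vectors_cong:
  assumes X: "\<And>x. x \<in> space M \<Longrightarrow> X x = X' x" and Y: "\<And>x. x \<in> space M \<Longrightarrow> Y x = Y' x"
  shows "indep_vectors M X Y \<longleftrightarrow> indep_vectors M X' Y'"
proof -
  have "X -` S \<inter> space M = X' -` S \<inter> space M" "Y -` T \<inter> space M = Y' -` T \<inter> space M" for S T
    using X Y by auto
  moreover have "X \<in> borel_measurable M \<longleftrightarrow> X' \<in> borel_measurable M"
    "Y \<in> borel_measurable M \<longleftrightarrow> Y' \<in> borel_measurable M"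
    using X Y by (auto intro!: measurable_cong)
  ultimately show ?thesis by (simp only: indep_vectors_def)
qed

lemma (in prob_space) indep_vectors_of_indep_vars:
  fixes X :: "'i \<Rightarrow> 'a \<Rightarrow> 'b::euclidean_space"
  assumes ind: "indep_vars (\<lambda>_. borel) X UNIV" and "i \<noteq> j"
  shows "indep_vectors M (X i) (X j)"
  unfolding indep_vectors_iff
proof (intro conjI ballI)
  show "X i \<in> borel_measurable M" "X j \<in> borel_measurable M"
    using ind by (auto simp: indep_vars_def)
  fix A B :: "'b set" assume "A \<in> sets borel" "B \<in> sets borel"
  then show "prob (X i -` A \<inter> space M \<inter> (X j -` B \<inter> space M))
      = prob (X i -` A \<inter> space M) * prob (X j -` B \<inter> space M)"
    using indep_varsD[OF ind, of "{i, j}" "\<lambda>k. if k = i then A else B"] \<open>i \<noteq> j\<close> by simp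
qed

lemma (in prob_space) mean_zero_of_iid_uncorrelated:
  fixes X :: "nat \<Rightarrow> 'a \<Rightarrow> real^'n"
  assumes iid: "iid_gaussian M X" and uncor: "mean_outer M (X i) (X j) = 0" and "i \<noteq> j"
  shows "integral\<^sup>L M (X i) = 0"
proof -
  have g: "gaussian M (X s)" for s using iid by (simp add: iid_gaussian_def)
  then have [measurable]: "X s \<in> borel_measurable M" and int: "integrable M (X s)" for s
    by (auto intro: square_integrable_integrable gaussian_square_integrable square_integrable_measurable)
  have ints: "integrable M (\<lambda>x. X s x $ k)" for s k
    by (rule integrable_bounded_linear[OF bounded_linear_vec_nth int])
  have "expectation (\<lambda>x. X i x $ k) = 0" for k
  proof -
    have "distr M borel (X i) = distr M borel (X j)"
      using iid by (simp add: iid_gaussian_def)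
    from arg_cong[OF this, of "\<lambda>D. \<integral>v. v $ k \<partial>D"]
    have same: "expectation (\<lambda>x. X i x $ k) = expectation (\<lambda>x. X j x $ k)"
      by (simp add: integral_distr)
    have "indep_vectors M (X i) (X j)"
      using iid \<open>i \<noteq> j\<close> by (auto simp: iid_gaussian_def intro: indep_vectors_of_indep_vars)
    then have "indep_vectors M (\<lambda>x. X i x $ k) (\<lambda>x. X j x $ k)"
      by (rule indep_vectors_comp[of _ _ "\<lambda>v. v $ k" "\<lambda>v. v $ k"]) measurable
    then have "indep_var borel (\<lambda>x. X i x $ k) borel (\<lambda>x. X j x $ k)"
      by (simp only: indep_var_iff_indep_vectors)
    then have "expectation (\<lambda>x. X i x $ k) * expectation (\<lambda>x. X j x $ k) = mean_outer M (X i) (X j) $ k $ k"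
      using indep_var_lebesgue_integral[OF _ ints ints] by (simp add: mean_outer_def)
    then show ?thesis using same uncor by simp
  qed
  then show ?thesis by (simp add: vec_eq_iff expectation_vec_nth[OF int])
qed

text \<open>Conditional entropy is built from the joint law and the law of \<open>Y\<close>, and
  these see only the values on \<open>space M\<close>.\<close>

lemma diff_cond_entropy_cong:
  assumes "prob_space M" and "1 < b"
    and X: "\<And>x. x \<in> space M \<Longrightarrow> X x = X' x" and Y: "\<And>x. x \<in> space M \<Longrightarrow> Y x = Y' x"
  shows "diff_cond_entropy b M X Y = diff_cond_entropy b M X' Y'"
proof -
  interpret information_space M b
    using assms(1,2) by (simp add: information_space_def information_space_axioms_def)
  have "distr M (lborel \<Otimes>\<^sub>M lborel) (\<lambda>x. (X x, Y x)) = distr M (lborel \<Otimes>\<^sub>M lborel) (\<lambda>x. (X' x, Y' x))"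
    "distr M lborel Y = distr M lborel Y'"
    using X Y by (auto intro!: distr_cong)
  then show ?thesis by (simp add: diff_cond_entropy_def conditional_entropy_def)
qed

text \<open>\<open>matrix_inv\<close> is defined by choice and is meaningful only once an inverse
  exists; the nonzero determinant provides one.\<close>

lemma matrix_inv_left_inverse:
  fixes A :: "real^'n^'n"
  assumes "det A \<noteq> 0"
  shows "matrix_inv A ** A = mat 1"
proof -
  have "\<exists>A'. A ** A' = mat 1 \<and> A' ** A = mat 1"
    using assms invertible_det_nz unfolding invertible_def by blast
  then show ?thesis unfolding matrix_inv_def by (rule someI2_ex) blast
qed

lemma matrix_mult_minus_left: "(- A) ** B = - (A ** (B :: real^'k^'n))"
  by (simp add: matrix_matrix_mult_def vec_eq_iff sum_negf)

theorem mainTheorem4: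
  fixes M :: "'a measure"
    and b :: real
    and A :: "real^'n^'n" and B :: "real^1^'n" and C :: "real^'n^1"
    and z :: "nat \<Rightarrow> 'a \<Rightarrow> real^'n" and u \<theta> \<omega> :: "nat \<Rightarrow> 'a \<Rightarrow> real^1"
    and \<Sigma>z :: "real^'n^'n" and \<Sigma>u \<Sigma>\<omega> :: "real^1^1"
    and z\<^sub>f :: "real^'n" and t :: nat
  assumes "prob_space M" and "1 < b"
    and state_eq: "\<And>s x. x \<in> space M \<Longrightarrow> z (Suc s) x = A *v z s x + B *v u s x"
    and output_eq: "\<And>s x. x \<in> space M \<Longrightarrow> \<theta> s x = C *v z s x + \<omega> s x"
    and noise_iid: "iid_gaussian M \<omega>" "\<And>s. integral\<^sup>L M (\<omega> s) = 0"
    and input_iid: "iid_gaussian M u" "\<And>r s. r \<noteq> s \<Longrightarrow> mean_outer M (u r) (u s) = 0"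
    and state_input: "\<And>s. gaussian M (\<lambda>x. (z s x, u s x))" "\<And>s. mean_outer M (z s) (u s) = 0"
    and noise_indep: "\<And>s. indep_vectors M (\<lambda>x. (z s x, u s x)) (\<lambda>x. (\<omega> s x, \<omega> (Suc s) x))"
    and cov: "\<Sigma>z = covariance M (z t)" "\<Sigma>u = covariance M (u t)" "\<Sigma>\<omega> = covariance M (\<omega> t)"
    and noise_nondegenerate: "det \<Sigma>\<omega> \<noteq> 0"
  shows "information_transfer b M \<theta> (frozen_output C z\<^sub>f \<omega>) t
           = 1 / 2 * log b (det (output_cond_cov A B C \<Sigma>z \<Sigma>u \<Sigma>\<omega>) / det \<Sigma>\<omega>)
       \<and> (AE x in M. cond_covariance M (\<theta> (Suc t)) (\<theta> t) x = output_cond_cov A B C \<Sigma>z \<Sigma>u \<Sigma>\<omega>)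
       \<and> covariance M (z (Suc t)) = next_state_cov A B \<Sigma>z \<Sigma>u"
proof -
  interpret information_space M b
    using \<open>prob_space M\<close> \<open>1 < b\<close> by (simp add: information_space_def information_space_axioms_def)
  \<comment> \<open>Everywhere-defined versions of the next state and of the two outputs; they agree
    with the given ones on \<open>space M\<close>, the only place where the equations are
    assumed.\<close>
  define z' where "z' = (\<lambda>x. A *v z t x + B *v u t x)"
  define y where "y = (\<lambda>x. C *v z t x + \<omega> t x)"
  define y' where "y' = (\<lambda>x. C *v z' x + \<omega> (Suc t) x)"
  have z': "z (Suc t) x = z' x" and y: "\<theta> t x = y x" and y': "\<theta> (Suc t) x = y' x" if "x \<in> space M" for x
    using that by (simp_all add: z'_def y_def y'_def state_eq output_eq)

  have g_noise: "gaussian M (\<omega> s)" and g_input: "gaussian M (u s)" for s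
    using noise_iid input_iid by (auto simp: iid_gaussian_def)
  have g_state: "gaussian M (z s)" for s
    using gaussian_linear[OF state_input(1) linear_fst] by simp
  have sq[simp]: "square_integrable M (\<omega> s)" "square_integrable M (u s)" "square_integrable M (z s)" for s
    by (intro gaussian_square_integrable g_noise g_input g_state)+
  have sq_mult[simp]: "square_integrable M (\<lambda>x. G *v X x)" if "square_integrable M X"
    for G :: "real^'k^'l" and X :: "'a \<Rightarrow> real^'k"
    by (rule square_integrable_linear[OF that matrix_vector_mul_linear])
  note [simp] = square_integrable_add square_integrable_integrable
  have sq'[simp]: "square_integrable M z'" "square_integrable M y"
    unfolding z'_def y_def by simp_all
  have sq_y'[simp]: "square_integrable M y'" unfolding y'_def by simp
  note [measurable] = sq[THEN square_integrable_measurable] sq'[THEN square_integrable_measurable]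
    sq_y'[THEN square_integrable_measurable]
  have [measurable]: "(\<lambda>v. G *v v) \<in> borel_measurable borel" for G :: "real^'k^'l"
    by (intro borel_measurable_continuous_onI linear_continuous_on matrix_vector_mul_bounded_linear)
  note bilinear = cross_covariance_add_left cross_covariance_add_right
    cross_covariance_mult_left cross_covariance_mult_right

  have indep_noise: "indep_vectors M (\<omega> t) (\<omega> (Suc t))"
    using noise_iid(1) by (auto simp: iid_gaussian_def intro: indep_vectors_of_indep_vars)
  have indep_state_noise: "indep_vectors M (\<lambda>x. f (z t x, u t x)) (\<lambda>x. g (\<omega> t x, \<omega> (Suc t) x))"
    if "linear f" "linear g" for f :: "(real^'n) \<times> (real^1) \<Rightarrow> real^'k" and g :: "(real^1) \<times> (real^1) \<Rightarrow> real^1"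
    using that by (intro indep_vectors_comp[OF noise_indep[of t]])
      (auto intro!: borel_measurable_continuous_onI linear_continuous_on simp: linear_conv_bounded_linear)
  have lin_z': "linear (\<lambda>p. A *v fst p + B *v snd p)"
    by (auto intro!: linearI simp: matrix_vector_right_distrib matrix_vector_mult_scaleR algebra_simps)
  have cross_noise: "cross_covariance M (\<omega> (Suc t)) (\<omega> t) = 0"
    using cross_covariance_indep_vectors[OF indep_noise]
    by (subst transpose_cross_covariance[symmetric]) (simp add: transpose_def vec_eq_iff)
  have cross_z_noise: "cross_covariance M (z t) (\<omega> t) = 0" "cross_covariance M (z t) (\<omega> (Suc t)) = 0"
    "cross_covariance M z' (\<omega> t) = 0" "cross_covariance M z' (\<omega> (Suc t)) = 0"
    using indep_state_noise[OF linear_fst linear_fst] indep_state_noise[OF linear_fst linear_snd]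
      indep_state_noise[OF lin_z' linear_fst] indep_state_noise[OF lin_z' linear_snd]
    by (auto intro!: cross_covariance_indep_vectors simp: z'_def)
  have cross_noise_z: "cross_covariance M (\<omega> t) (z t) = 0" "cross_covariance M (\<omega> (Suc t)) (z t) = 0"
    "cross_covariance M (\<omega> t) z' = 0" "cross_covariance M (\<omega> (Suc t)) z' = 0"
    using cross_z_noise[THEN arg_cong[of _ _ transpose]]
    by (simp_all add: transpose_cross_covariance) (simp_all add: transpose_def vec_eq_iff)
  \<comment> \<open>The assumption on state and input concerns a second moment. As
    \<open>z t\<close> may have nonzero mean, the vanishing mean of \<open>u t\<close> is what turns
    it into a statement about covariance.\<close>
  have input_mean: "integral\<^sup>L M (u t) = 0"
    using mean_zero_of_iid_uncorrelated[OF input_iid(1) input_iid(2)[of t "Suc t"]] by simp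
  have cross_zu: "cross_covariance M (z t) (u t) = 0"
    using state_input(2) by (simp add: cross_covariance_centered_right input_mean)
  then have cross_uz: "cross_covariance M (u t) (z t) = 0"
    by (subst transpose_cross_covariance[symmetric]) (simp add: transpose_def vec_eq_iff)

  have zero_mult[simp]: "(0 :: real^'k^'l) ** (G :: real^'h^'k) = 0" "(H :: real^'k^'l) ** (0 :: real^'h^'k) = 0"
    for G and H
    by (simp_all add: matrix_matrix_mult_def vec_eq_iff)
  note cov' = cov[unfolded covariance_eq_cross_covariance, symmetric]
  have cov_z': "cross_covariance M z' z' = next_state_cov A B \<Sigma>z \<Sigma>u"
    unfolding z'_def next_state_cov_def
    by (simp add: bilinear cross_zu cross_uz cov' matrix_mul_assoc)
  have cov_noise': "cross_covariance M (\<omega> (Suc t)) (\<omega> (Suc t)) = \<Sigma>\<omega>"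
  proof -
    have "covariance M (\<omega> (Suc t)) = covariance (distr M borel (\<omega> (Suc t))) (\<lambda>v. v)"
      by (simp add: covariance_distr)
    also have "distr M borel (\<omega> (Suc t)) = distr M borel (\<omega> t)"
      using noise_iid(1) by (simp add: iid_gaussian_def)
    also have "covariance (distr M borel (\<omega> t)) (\<lambda>v. v) = \<Sigma>\<omega>"
      by (simp add: covariance_distr cov)
    finally show ?thesis by (simp add: covariance_eq_cross_covariance)
  qed
  define S where "S = C ** \<Sigma>z ** transpose C + \<Sigma>\<omega>"
  define \<Gamma> where "\<Gamma> = C ** A ** \<Sigma>z ** transpose C"
  have cov_y: "cross_covariance M y y = S"
    unfolding y_def S_def by (simp add: bilinear cross_z_noise cross_noise_z cov' matrix_mul_assoc)
  have cov_y': "cross_covariance M y' y' = C ** next_state_cov A B \<Sigma>z \<Sigma>u ** transpose C + \<Sigma>\<omega>"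
    unfolding y'_def
    by (simp add: bilinear cross_z_noise cross_noise_z cov_z' cov_noise' matrix_mul_assoc)
  have cov_z'z: "cross_covariance M z' (z t) = A ** \<Sigma>z"
    unfolding z'_def by (simp add: bilinear cross_uz cov')
  have cov_y'y: "cross_covariance M y' y = \<Gamma>"
    unfolding y'_def y_def \<Gamma>_def
    by (simp add: bilinear cross_z_noise cross_noise_z cross_noise cov_z'z matrix_mul_assoc)

  have noise_pos: "0 < \<Sigma>\<omega> $ 1 $ 1"
    using noise_nondegenerate covariance_diag_nonneg[of "\<omega> t" 1] by (simp add: det_1 cov)
  \<comment> \<open>This entry is the variance of \<open>C *v z t\<close>. Adding the positive noise
    variance makes \<open>S\<close> invertible even for singular \<open>\<Sigma>z\<close>.\<close>
  have "0 \<le> (C ** \<Sigma>z ** transpose C) $ 1 $ 1"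
    using covariance_diag_nonneg[of "\<lambda>x. C *v z t x" 1]
    by (simp add: covariance_eq_cross_covariance bilinear cov' matrix_mul_assoc)
  then have S_pos: "0 < S $ 1 $ 1" using noise_pos by (simp add: S_def)
  then have S_inv: "matrix_inv S ** S = mat 1" by (simp add: matrix_inv_left_inverse det_1)

  \<comment> \<open>The prediction error of the best linear predictor of \<open>\<theta> (Suc t)\<close> from \<open>\<theta> t\<close>.\<close>
  define K where "K = - (\<Gamma> ** matrix_inv S)"
  \<comment> \<open>Two versions of the error that agree on \<open>space M\<close>. \<open>W\<close>
    is used for moments, independence and entropy. \<open>V\<close> is built from
    \<open>\<theta>\<close> itself, so that adding back the prediction gives
    \<open>\<theta> (Suc t)\<close> as a function on the whole type; this allows plain rewriting
    inside \<open>cond_covariance\<close>.\<close>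
  define V where "V = (\<lambda>x. \<theta> (Suc t) x + K *v \<theta> t x)"
  define W where "W = (\<lambda>x. y' x + K *v y x)"
  have VW: "V x = W x" if "x \<in> space M" for x using that by (simp add: V_def W_def y y')
  have sq_W[simp]: "square_integrable M W" unfolding W_def by simp
  \<comment> \<open>The normal equation: the covariance of the error with the current output is
    \<open>\<Gamma> + K ** S\<close>, which this choice of \<open>K\<close> makes zero.\<close>
  have KS: "K ** S = - \<Gamma>"
    unfolding K_def matrix_mult_minus_left matrix_mul_assoc[symmetric] S_inv by simp
  have cross_Wy: "cross_covariance M W y = 0"
    unfolding W_def by (simp add: bilinear cov_y'y cov_y KS)
  have cov_W: "cross_covariance M W W = output_cond_cov A B C \<Sigma>z \<Sigma>u \<Sigma>\<omega>"
  proof -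
    \<comment> \<open>Only the right argument is expanded at first. Its \<open>K\<close> part is
      annihilated by \<open>cross_Wy\<close>, and expanding the left argument of the rest gives the
      Schur complement directly.\<close>
    have "cross_covariance M W W = cross_covariance M W y' + cross_covariance M W y ** transpose K"
      by (subst (2) W_def) (simp add: bilinear)
    also have "\<dots> = cross_covariance M y' y' + K ** cross_covariance M y y'"
      unfolding cross_Wy by (simp add: W_def bilinear)
    also have "cross_covariance M y y' = transpose \<Gamma>"
      unfolding cov_y'y[symmetric] by (rule transpose_cross_covariance[symmetric])
    finally show ?thesis
      unfolding output_cond_cov_def cov_y' K_def matrix_mult_minus_left S_def \<Gamma>_def by simp
  qed
  have cov_W_pos: "0 < cross_covariance M W W $ 1 $ 1"
  proof -
    \<comment> \<open>Everything in the error except the newest noise. It is built from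
      \<open>z'\<close> and the current output, both uncorrelated with
      \<open>\<omega> (Suc t)\<close>, so the two variances add.\<close>
    define R where "R = (\<lambda>x. C *v z' x + K *v y x)"
    have [simp]: "square_integrable M R" unfolding R_def by simp
    have W: "W = (\<lambda>x. R x + \<omega> (Suc t) x)" by (simp add: W_def R_def y'_def algebra_simps)
    have "cross_covariance M y (\<omega> (Suc t)) = 0"
      unfolding y_def using cross_covariance_indep_vectors[OF indep_noise]
      by (simp add: bilinear cross_z_noise)
    then have "cross_covariance M R (\<omega> (Suc t)) = 0"
      unfolding R_def by (simp add: bilinear cross_z_noise)
    moreover from this have "cross_covariance M (\<omega> (Suc t)) R = 0"
      by (subst transpose_cross_covariance[symmetric]) (simp add: transpose_def vec_eq_iff)
    ultimately have "cross_covariance M W W = cross_covariance M R R + \<Sigma>\<omega>"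
      unfolding W by (simp add: bilinear cov_noise')
    then show ?thesis
      using noise_pos covariance_diag_nonneg[of R 1] by (simp add: covariance_eq_cross_covariance)
  qed

  have g_yy: "gaussian M (\<lambda>x. (y' x, y x))"
  proof -
    let ?L = "\<lambda>p. (C *v (A *v fst p + B *v snd p), C *v fst p)"
    have lin: "linear ?L"
      by (auto intro!: linearI simp: matrix_vector_right_distrib matrix_vector_mult_scaleR algebra_simps)
    \<comment> \<open>The independent noises are placed in complementary coordinates, so that the
      pair becomes a sum of independent Gaussian vectors.\<close>
    have "gaussian M (\<lambda>x. (0, \<omega> t x) + (\<omega> (Suc t) x, 0))"
    proof (rule gaussian_add)
      show "gaussian M (\<lambda>x. (0 :: real^1, \<omega> t x))" "gaussian M (\<lambda>x. (\<omega> (Suc t) x, 0 :: real^1))"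
        by (intro gaussian_linear[OF g_noise, of "\<lambda>v. (0, v)"] gaussian_linear[OF g_noise, of "\<lambda>v. (v, 0)"] linearI; simp)+
      show "indep_vectors M (\<lambda>x. (0 :: real^1, \<omega> t x)) (\<lambda>x. (\<omega> (Suc t) x, 0 :: real^1))"
        by (rule indep_vectors_comp[OF indep_noise]) (intro borel_measurable_continuous_onI continuous_intros)+
    qed
    then have g2: "gaussian M (\<lambda>x. (\<omega> (Suc t) x, \<omega> t x))" by simp
    have "gaussian M (\<lambda>x. ?L (z t x, u t x) + (\<omega> (Suc t) x, \<omega> t x))"
    proof (rule gaussian_add[OF gaussian_linear[OF state_input(1) lin] g2])
      have mL: "?L \<in> borel_measurable borel"
        using lin by (intro borel_measurable_continuous_onI linear_continuous_on) (simp only: linear_conv_bounded_linear)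
      \<comment> \<open>\<open>noise_indep\<close> lists the current noise first, the output pair
        the later time first; hence the swap.\<close>
      have mS: "(\<lambda>p :: (real^1) \<times> (real^1). (snd p, fst p)) \<in> borel_measurable borel"
        by (intro borel_measurable_continuous_onI continuous_intros)
      show "indep_vectors M (\<lambda>x. ?L (z t x, u t x)) (\<lambda>x. (\<omega> (Suc t) x, \<omega> t x))"
        using indep_vectors_comp[OF noise_indep[of t] mL mS] by simp
    qed
    then show ?thesis by (simp add: y'_def y_def z'_def)
  qed
  have g_y: "gaussian M y" using gaussian_linear[OF g_yy linear_snd] by simp
  have lin_W: "linear (\<lambda>p :: (real^1) \<times> (real^1). fst p + K *v snd p)"
    by (auto intro!: linearI simp: matrix_vector_right_distrib matrix_vector_mult_scaleR algebra_simps)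
  have g_W: "gaussian M W" using gaussian_linear[OF g_yy lin_W] by (simp add: W_def)
  have indep_Wy: "indep_vectors M W y"
  proof -
    \<comment> \<open>The independence criterion is for real variables, so it is applied to the
      single coordinates; \<open>vec\<close> lifts the result back to \<open>real^1\<close>.\<close>
    have "gaussian M (\<lambda>x. (W x $ 1, y x $ 1))"
      using gaussian_linear[OF g_yy, of "\<lambda>p. ((fst p + K *v snd p) $ 1, snd p $ 1)"]
      by (simp add: W_def linear_iff matrix_vector_right_distrib matrix_vector_mult_scaleR algebra_simps)
    moreover have "expectation (\<lambda>x. (W x $ 1 - expectation (\<lambda>x. W x $ 1)) * (y x $ 1 - expectation (\<lambda>x. y x $ 1)))
        = cross_covariance M W y $ 1 $ 1"
      by (simp add: cross_covariance_def mean_outer_def expectation_vec_nth)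
    ultimately have "indep_vectors M (\<lambda>x. W x $ 1) (\<lambda>x. y x $ 1)"
      unfolding indep_var_iff_indep_vectors[symmetric]
      by (intro indep_var_of_gaussian_uncorrelated) (simp_all add: cross_Wy)
    from indep_vectors_comp[OF this borel_measurable_vec1 borel_measurable_vec1]
    show ?thesis by (simp add: vec_eq_iff flip: vec_lambda_eta)
  qed

  define h where "h = (\<lambda>v. - (K *v v))"
  have [measurable]: "h \<in> borel_measurable borel" unfolding h_def by measurable
  have y'_shift: "y' = (\<lambda>x. W x + h (y x))" by (simp add: W_def h_def)
  have ent: "diff_cond_entropy b M (\<theta> (Suc t)) (\<theta> t)
      = log b (2 * pi * exp 1 * output_cond_cov A B C \<Sigma>z \<Sigma>u \<Sigma>\<omega> $ 1 $ 1) / 2"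
  proof -
    have "diff_cond_entropy b M (\<theta> (Suc t)) (\<theta> t) = diff_cond_entropy b M (\<lambda>x. W x + h (y x)) y"
      by (rule diff_cond_entropy_cong[OF assms(1,2)]) (simp_all add: y y' y'_shift)
    also have "\<dots> = log b (2 * pi * exp 1 * covariance M W $ 1 $ 1) / 2"
      using cov_W_pos S_pos
      by (intro diff_cond_entropy_indep_gaussian[OF indep_Wy g_W g_y])
        (simp_all add: covariance_eq_cross_covariance cov_y)
    finally show ?thesis by (simp add: covariance_eq_cross_covariance cov_W)
  qed
  have ent_frozen: "diff_cond_entropy b M (frozen_output C z\<^sub>f \<omega> (Suc t)) (frozen_output C z\<^sub>f \<omega> t)
      = log b (2 * pi * exp 1 * \<Sigma>\<omega> $ 1 $ 1) / 2"
  proof -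
    let ?c = "C *v z\<^sub>f"
    let ?y = "\<lambda>x. ?c + \<omega> t x"
    have "indep_vectors M (\<omega> (Suc t)) (\<omega> t)"
      using noise_iid(1) by (auto simp: iid_gaussian_def intro: indep_vectors_of_indep_vars)
    then have ind: "indep_vectors M (\<omega> (Suc t)) ?y" by (rule indep_vectors_add_const_right)
    have g: "gaussian M ?y"
      by (rule gaussian_add[OF gaussian_const g_noise indep_vectors_const_left]) measurable
    have "frozen_output C z\<^sub>f \<omega> (Suc t) = (\<lambda>x. \<omega> (Suc t) x + (\<lambda>_. ?c) (?y x))"
      "frozen_output C z\<^sub>f \<omega> t = ?y"
      by (auto simp: frozen_output_def add.commute)
    moreover have "diff_cond_entropy b M (\<lambda>x. \<omega> (Suc t) x + (\<lambda>_. ?c) (?y x)) ?y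
        = log b (2 * pi * exp 1 * covariance M (\<omega> (Suc t)) $ 1 $ 1) / 2"
      using noise_pos
      by (intro diff_cond_entropy_indep_gaussian[OF ind g_noise g])
        (simp_all add: covariance_add_const flip: cov, simp_all add: covariance_eq_cross_covariance cov_noise')
    ultimately show ?thesis by (simp add: covariance_eq_cross_covariance cov_noise')
  qed
  have transfer: "information_transfer b M \<theta> (frozen_output C z\<^sub>f \<omega>) t
      = 1 / 2 * log b (det (output_cond_cov A B C \<Sigma>z \<Sigma>u \<Sigma>\<omega>) / det \<Sigma>\<omega>)"
  proof -
    have p: "0 < output_cond_cov A B C \<Sigma>z \<Sigma>u \<Sigma>\<omega> $ 1 $ 1" using cov_W_pos by (simp add: cov_W)
    have pe: "0 < 2 * pi * exp (1 :: real)" by simp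
    \<comment> \<open>The common term \<open>log b (2 * pi * exp 1)\<close> cancels in the
      difference of the entropies. Positivity of both variances permits splitting the
      logarithms.\<close>
    have split: "log b (2 * pi * exp 1 * r) = log b (2 * pi * exp 1) + log b r" if "0 < r" for r
      using that pe \<open>1 < b\<close> by (simp only: log_mult_pos)
    then show ?thesis
      using p noise_pos unfolding information_transfer_def ent ent_frozen det_1 split[OF p] split[OF noise_pos]
      by (simp add: log_divide_pos add_divide_distrib diff_divide_distrib)
  qed
  have cond: "AE x in M. cond_covariance M (\<theta> (Suc t)) (\<theta> t) x = output_cond_cov A B C \<Sigma>z \<Sigma>u \<Sigma>\<omega>"
  proof -
    have "indep_vectors M V (\<theta> t)"
      using indep_Wy indep_vectors_cong[of M V W "\<theta> t" y] by (simp add: VW y)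
    moreover have "square_integrable M V"
      using g_W gaussian_cong[of M V W] by (simp add: VW gaussian_square_integrable)
    moreover have "integrable M (\<lambda>x. h (\<theta> t x))"
    proof -
      have "square_integrable M (\<theta> t)"
        using g_y gaussian_cong[of M "\<theta> t" y] by (simp add: y gaussian_square_integrable)
      then show ?thesis unfolding h_def by simp
    qed
    ultimately have "AE x in M. cond_covariance M (\<lambda>x. V x + h (\<theta> t x)) (\<theta> t) x = covariance M V"
      by (intro cond_covariance_indep_shift) measurable
    moreover have "(\<lambda>x. V x + h (\<theta> t x)) = \<theta> (Suc t)" by (simp add: V_def h_def)
    moreover have "covariance M V = output_cond_cov A B C \<Sigma>z \<Sigma>u \<Sigma>\<omega>"
      unfolding cov_W[symmetric] covariance_eq_cross_covariance by (intro cross_covariance_cong VW)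
    ultimately show ?thesis by simp
  qed
  have next_cov: "covariance M (z (Suc t)) = next_state_cov A B \<Sigma>z \<Sigma>u"
    using cov_z' cross_covariance_cong[of M "z (Suc t)" z' "z (Suc t)" z'] z'
    by (simp add: covariance_eq_cross_covariance)
  show ?thesis using transfer cond next_cov by blast
qed

end
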